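(* Let $\{\gamma_k\}_{k=0}^\infty$ be a non-trivial Hermite multiplier sequence, and let $\{Q_k(x)\}_{k=0}^\infty$ be the real polynomials such that $$T[H_n(x)]:=\left(\sum_{k=0}^\infty Q_k(x)D^k\right)H_n(x)=\gamma_nH_n(x)\qquad\text{for all } n\in\mathbb{N}_0.$$ Then each $Q_k(x)$ has only real zeros.
   Context: $\mathbb{N}_0=\{0,1,2,\ldots\}$ and $D:=\frac{d}{dx}$. The Hermite polynomials are $H_n(x)=\sum_{k=0}^{\lfloor n/2\rfloor}\frac{(-1)^k n!\,2^{n-2k}}{k!(n-2k)!}x^{n-2k}$. Every linear operator on $\mathbb{R}[x]$ has a unique representation $\sum_{k=0}^\infty Q_k(x)D^k$ with $Q_k\in\mathbb{R}[x]$. A linear operator $T:\mathbb{R}[x]\to\mathbb{R}[x]$ is hyperbolicity preserving if $T[p(x)]$ has only real zeros whenever $p(x)\in\mathbb{R}[x]$ has only real zeros. Throughout, the zero polynomial is regarded as having only real zeros. A sequence of real numbers $\{\gamma_n\}_{n=0}^\infty$ is a Hermite multiplier sequence if the linear operator defined by $T[H_n(x)]=\gamma_nH_n(x)$ for all $n\in\mathbb{N}_0$ is hyperbolicity preserving. It is trivial if it is of the form $\{0,0,\ldots,0,\alpha,\beta,0,0,\ldots\}$ with $\alpha,\beta\in\mathbb{R}$ (all terms zero except possibly two consecutive ones), and non-trivial otherwise. *)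

theory Defs
  imports Complex_Main "HOL-Computational_Algebra.Polynomial"
begin

definition hermite :: "nat \<Rightarrow> real poly" where
  "hermite n = (\<Sum>k\<le>n div 2.
     monom ((-1) ^ k * fact n * 2 ^ (n - 2 * k) / (fact k * fact (n - 2 * k))) (n - 2 * k))"

text \<open>``Only real zeros'' refers to the complex zeros; the zero polynomial is included
  by convention.\<close>

definition only_real_zeros :: "real poly \<Rightarrow> bool" where
  "only_real_zeros p \<longleftrightarrow>
     p = 0 \<or> (\<forall>z. poly (map_poly complex_of_real p) z = 0 \<longrightarrow> z \<in> \<real>)"

definition hyperbolicity_preserving :: "(real poly \<Rightarrow> real poly) \<Rightarrow> bool" where
  "hyperbolicity_preserving T \<longleftrightarrow>
     Vector_Spaces.linear smult smult T \<and>
     (\<forall>p. only_real_zeros p \<longrightarrow> only_real_zeros (T p))"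

text \<open>The polynomials \<^term>\<open>hermite n\<close> have degree \<^term>\<open>n\<close> and so form a basis: there is
  exactly one linear operator with the prescribed values, and the existential quantifier
  just names it.\<close>

definition hermite_multiplier_sequence :: "(nat \<Rightarrow> real) \<Rightarrow> bool" where
  "hermite_multiplier_sequence \<gamma> \<longleftrightarrow>
     (\<exists>T. Vector_Spaces.linear smult smult T \<and>
          (\<forall>n. T (hermite n) = smult (\<gamma> n) (hermite n)) \<and>
          hyperbolicity_preserving T)"

definition trivial_sequence :: "(nat \<Rightarrow> real) \<Rightarrow> bool" where
  "trivial_sequence \<gamma> \<longleftrightarrow>
     (\<exists>m \<alpha> \<beta>. \<gamma> = (\<lambda>n. if n = m then \<alpha> else if n = Suc m then \<beta> else 0))"

text \<open>The operator \<open>\<Sum>k. Q\<^sub>k(x) D\<^sup>k\<close>. Applied to \<open>p\<close>, all terms with \<open>k\<close> above the degree of \<open>p\<close>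
  vanish, so the infinite sum can be cut off there.\<close>

definition diff_operator :: "(nat \<Rightarrow> real poly) \<Rightarrow> real poly \<Rightarrow> real poly" where
  "diff_operator Q p = (\<Sum>k\<le>degree p. Q k * (pderiv ^^ k) p)"

lemma higher_pderiv_degree_less:
  fixes p :: "real poly"
  assumes "degree p < k"
  shows "(pderiv ^^ k) p = 0"
  using assms
proof (induction k arbitrary: p)
  case (Suc k)
  show ?case
  proof (cases "degree p = 0")
    case True
    then have "pderiv p = 0" by (simp add: pderiv_eq_0_iff)
    moreover have "(pderiv ^^ k) (0 :: real poly) = 0" by (induction k) auto
    ultimately show ?thesis by (simp add: funpow_Suc_right del: funpow.simps)
  next
    case False
    then have "degree (pderiv p) < k" using Suc.prems by (simp add: degree_pderiv)
    then show ?thesis using Suc.IH by (simp add: funpow_Suc_right del: funpow.simps)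
  qed
qed simp

lemma diff_operator_cutoff:
  assumes "degree p \<le> N"
  shows "diff_operator Q p = (\<Sum>k\<le>N. Q k * (pderiv ^^ k) p)"
  unfolding diff_operator_def
  by (rule sum.mono_neutral_left) (use assms in \<open>auto simp: higher_pderiv_degree_less\<close>)

end

theory Submission
  imports Defs "HOL-Computational_Algebra.Fundamental_Theorem_Algebra"
begin

text \<open>
The coefficients \<open>Q\<^sub>k\<close> can be written down. Let \<open>L\<close> be the linear functional on polynomials in an
auxiliary variable \<open>s\<close> with \<open>L (s^n) = \<gamma>\<^sub>n\<close>, so that \<open>L ((s - 1)^m p)\<close> evaluates \<open>p\<close> against the
\<open>m\<close>-th forward differences of \<open>\<gamma>\<close>. For \<open>\<gamma>\<^sub>n = s^n\<close> the generating function \<open>exp (2xt - t^2)\<close> of the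
Hermite polynomials gives \<open>\<Sum>k. Q\<^sub>k(x) (2t)^k = exp (2xt(s - 1) - t^2(s^2 - 1))\<close>, and the general case
follows by applying \<open>L\<close>. Up to a positive constant factor, with \<open>k = 2m + e\<close> and \<open>e\<close> equal to 0 or 1, this says
\<open>Q\<^sub>k(x) = x^e R(x^2)\<close> where \<open>R(y) = \<Sum>i\<le>m. r\<^sub>i L ((s - 1)^(k-m+i) (s + 1)^(m-i)) y^i\<close>.
Here the numbers \<open>r\<^sub>i\<close> are the coefficients of the Hermite polynomial itself: \<open>H\<^sub>k(x)\<close> is a positive
multiple of \<open>x^e \<Sum>i\<le>m. r\<^sub>i x^(2i)\<close>. It suffices that \<open>R\<close> vanishes identically or has only zeros
in \<open>[0, \<infinity>)\<close>.

No zeros off the real axis (\<open>half_polynomial_upper_half_plane\<close>): if \<open>Im y > 0\<close>, the polynomial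
\<open>\<Sum>i\<le>m. r\<^sub>i y^i (s - 1)^i (s + 1)^(m-i)\<close> in \<open>s\<close> has the zeros \<open>(y + z) / (y - z)\<close>, where \<open>z\<close> runs
through the zeros of \<open>\<Sum>i\<le>m. r\<^sub>i z^i\<close>. These \<open>z\<close> are positive because \<open>H\<^sub>k\<close> has only real zeros, so
all zeros in \<open>s\<close> have negative imaginary part. The value \<open>R(y)\<close> pairs this polynomial with the
Jensen polynomial of the sequence of \<open>(k - m)\<close>-th differences of \<open>\<gamma>\<close>, which has only real zeros, and
by Grace's theorem (\<open>grace_nonvanishing\<close>) such a pairing is nonzero unless the Jensen polynomial
vanishes. The Jensen polynomials of \<open>\<gamma>\<close> itself have only real zeros because they are limits of
rescaled images of \<open>(1 + x)^n\<close>, and Laguerre's theorem on polar derivatives passes this on to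
differences.

No negative zeros (\<open>differences_sign\<close>): the signs of the \<open>r\<^sub>i\<close> alternate, so it is enough that the
numbers \<open>L ((s - 1)^p (s + 1)^q)\<close> with \<open>p + q = k\<close> all have the same weak sign. Up to a constant
sign and a factor \<open>(-1)^n\<close> the sequence \<open>\<gamma>\<close> is nonnegative, and for a nonnegative \<open>\<gamma>\<close> it is enough
that all its forward differences are nonnegative. The operator gives this for steps of length two:
the image of \<open>x^n\<close> is a real-rooted even or odd polynomial, so its coefficients alternate, which says
\<open>L ((s^2 - 1)^m s^l) \<ge> 0\<close>. To pass to steps of length one, let \<open>b\<close> be the sequence of \<open>m\<close>-th
differences, nonnegative by induction. It is log-concave by real-rootedness of its Jensen
polynomials, so if it ever decreased it would decay geometrically from there on. But with the shift
operator \<open>E\<close> the sequence \<open>(E + 1)^(m+1) b\<close> is nondecreasing, hence cannot tend to 0. So \<open>b\<close> is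
nondecreasing, and the next differences are nonnegative (\<open>forward_differences_nonneg\<close>).

A sign argument of this kind needs the leading coefficient \<open>\<gamma>\<^sub>n\<close> of the image of \<open>x^n\<close> to be nonzero
as soon as some earlier term of \<open>\<gamma>\<close> is. This is where non-triviality enters: a sequence with two
nonzero terms at distance two cannot stop, because otherwise \<open>x^(N+2) - a x^(N+4)\<close> for a suitable
\<open>a > 0\<close> would have an image with nonreal zeros (\<open>no_last_term\<close>).
\<close>

section \<open>Zeros of real polynomials in the complex plane\<close>

abbreviation complex_poly :: "real poly \<Rightarrow> complex poly" where
  "complex_poly \<equiv> map_poly complex_of_real"

lemma complex_poly_add [simp]: "complex_poly (p + q) = complex_poly p + complex_poly q"
  by (rule poly_eqI) (simp add: coeff_map_poly)

lemma complex_poly_diff [simp]: "complex_poly (p - q) = complex_poly p - complex_poly q"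
  by (rule poly_eqI) (simp add: coeff_map_poly)

lemma complex_poly_smult [simp]: "complex_poly (smult c p) = smult (of_real c) (complex_poly p)"
  by (rule poly_eqI) (simp add: coeff_map_poly)

lemma complex_poly_pCons [simp]: "complex_poly (pCons a p) = pCons (of_real a) (complex_poly p)"
  by (rule poly_eqI) (simp add: coeff_map_poly coeff_pCons split: nat.splits)

lemma complex_poly_sum [simp]: "complex_poly (sum f A) = (\<Sum>x\<in>A. complex_poly (f x))"
  by (induction A rule: infinite_finite_induct) auto

lemma complex_poly_mult [simp]: "complex_poly (p * q) = complex_poly p * complex_poly q"
  by (induction p) (auto simp: )

lemma complex_poly_power [simp]: "complex_poly (p ^ n) = complex_poly p ^ n"
  by (induction n) auto

lemma complex_poly_monom [simp]: "complex_poly (monom c n) = monom (of_real c) n"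
  by (simp add: map_poly_monom)

lemma complex_poly_pderiv [simp]: "complex_poly (pderiv p) = pderiv (complex_poly p)"
  by (rule poly_eqI) (simp add: coeff_map_poly coeff_pderiv)

lemma complex_poly_eq_0_iff [simp]: "complex_poly p = 0 \<longleftrightarrow> p = 0"
  by (auto simp: poly_eq_iff coeff_map_poly)

lemma degree_complex_poly [simp]: "degree (complex_poly p) = degree p"
  by (rule degree_map_poly) auto

lemma complex_poly_pcompose: "complex_poly (pcompose p q) = pcompose (complex_poly p) (complex_poly q)"
  by (induction p) (auto simp: pcompose_pCons)

lemma poly_complex_poly_cnj: "poly (complex_poly p) (cnj z) = cnj (poly (complex_poly p) z)"
  by (induction p) auto

lemma poly_complex_poly_of_real [simp]:
  "poly (complex_poly p) (of_real x) = of_real (poly p x)"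
  by (induction p) auto

lemma only_real_zerosI:
  assumes "\<And>z. Im z > 0 \<Longrightarrow> poly (complex_poly p) z \<noteq> 0"
  shows "only_real_zeros p"
  unfolding only_real_zeros_def
proof (intro disjI2 allI impI)
  fix z assume z: "poly (complex_poly p) z = 0"
  show "z \<in> \<real>"
  proof (rule ccontr)
    assume "z \<notin> \<real>"
    then have "Im z > 0 \<or> Im (cnj z) > 0"
      by (auto simp: complex_is_Real_iff)
    then show False
      using assms[of z] assms[of "cnj z"] z by (auto simp: poly_complex_poly_cnj)
  qed
qed

lemma only_real_zerosD:
  assumes "only_real_zeros p" "p \<noteq> 0" "poly (complex_poly p) z = 0"
  shows "Im z = 0"
  using assms by (auto simp: only_real_zeros_def complex_is_Real_iff)

lemma only_real_zeros_0 [simp]: "only_real_zeros 0"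
  by (simp add: only_real_zeros_def)

lemma only_real_zeros_mult:
  assumes "only_real_zeros p" "only_real_zeros q"
  shows "only_real_zeros (p * q)"
  using assms by (auto simp: only_real_zeros_def)

lemma only_real_zeros_factor:
  assumes "only_real_zeros (p * q)" "p \<noteq> 0"
  shows "only_real_zeros q"
  using assms by (auto simp: only_real_zeros_def)

lemma only_real_zeros_power:
  assumes "only_real_zeros p"
  shows "only_real_zeros (p ^ n)"
  by (induction n) (use assms in \<open>auto intro: only_real_zeros_mult simp: only_real_zeros_def\<close>)


lemma only_real_zeros_linear: "b \<noteq> 0 \<Longrightarrow> only_real_zeros [:a, b:]"
proof (rule only_real_zerosI)
  fix z :: complex assume "Im z > 0" "b \<noteq> 0"
  then show "poly (complex_poly [:a, b:]) z \<noteq> 0" by (simp add: complex_eq_iff)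
qed

lemma only_real_zeros_monom: "only_real_zeros (monom 1 k)"
  by (rule only_real_zerosI) (auto simp: poly_monom)

lemma only_real_zeros_smult_iff:
  "c \<noteq> 0 \<Longrightarrow> only_real_zeros (smult c p) \<longleftrightarrow> only_real_zeros p"
  by (auto simp: only_real_zeros_def)

lemma only_real_zeros_dilate:
  assumes "only_real_zeros p" "c \<noteq> 0"
  shows "only_real_zeros (pcompose p [:0, c:])"
proof (cases "p = 0")
  case False
  show ?thesis
  proof (rule only_real_zerosI)
    fix z :: complex assume "Im z > 0"
    then have "Im (z * of_real c) \<noteq> 0" using assms(2) by simp
    then show "poly (complex_poly (pcompose p [:0, c:])) z \<noteq> 0"
      using only_real_zerosD[OF assms(1) False, of "z * of_real c"]
      by (auto simp: complex_poly_pcompose poly_pcompose)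
  qed
qed auto

text \<open>The zeros of a polynomial, listed with multiplicity in some order; the values of the enumeration
from the degree on are arbitrary.\<close>

definition root_list :: "complex poly \<Rightarrow> (nat \<Rightarrow> complex) \<Rightarrow> bool" where
  "root_list p r \<longleftrightarrow> p = smult (lead_coeff p) (\<Prod>i<degree p. [:-r i, 1:])"

lemma root_list_exists:
  obtains r where "root_list p r"
  using complex_poly_decompose'[of p] unfolding root_list_def by metis

lemma root_list_poly:
  assumes "root_list p r"
  shows "poly p s = lead_coeff p * (\<Prod>i<degree p. s - r i)"
  by (subst assms[unfolded root_list_def]) (simp add: poly_prod)

lemma root_list_root:
  assumes "root_list p r" "i < degree p"
  shows "poly p (r i) = 0"
  using assms by (auto simp: root_list_poly)

lemma root_list_log_derivative:
  assumes r: "root_list p r" and s: "poly p s \<noteq> 0"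
  shows "poly (pderiv p) s / poly p s = (\<Sum>i<degree p. 1 / (s - r i))"
proof -
  define f where "f n = (\<Prod>i<n. [:-r i, 1:])" for n
  have f: "p = smult (lead_coeff p) (f (degree p))" using r by (simp add: f_def root_list_def)
  have "poly (pderiv (f n)) s = poly (f n) s * (\<Sum>i<n. 1 / (s - r i))"
    if "\<And>i. i < n \<Longrightarrow> s \<noteq> r i" for n
    using that
  proof (induction n)
    case (Suc n)
    have ne: "s - r n \<noteq> 0" using Suc.prems[of n] by simp
    have "f (Suc n) = f n * [:-r n, 1:]" by (simp add: f_def)
    then have "poly (pderiv (f (Suc n))) s = poly (f n) s + poly (pderiv (f n)) s * (s - r n)"
      by (simp only: pderiv_mult poly_add poly_mult) (simp add: pderiv_pCons algebra_simps)
    also have "\<dots> = poly (f n) s * (s - r n) * (1 / (s - r n) + (\<Sum>i<n. 1 / (s - r i)))"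
      using Suc ne by (simp add: field_simps)
    also have "poly (f n) s * (s - r n) = poly (f (Suc n)) s"
      by (simp add: f_def poly_prod algebra_simps)
    finally show ?case by (simp add: add.commute)
  qed (simp add: f_def)
  moreover have "s \<noteq> r i" if "i < degree p" for i
    using root_list_root[OF r that] s by auto
  ultimately have "poly (pderiv p) s = poly p s * (\<Sum>i<degree p. 1 / (s - r i))"
    by (subst (1 2) f) (simp add: pderiv_smult)
  then show ?thesis using s by simp
qed

lemma root_list_sum:
  assumes r: "root_list p r" and deg: "degree p = Suc n"
  shows "coeff p n = - lead_coeff p * (\<Sum>i<Suc n. r i)"
proof -
  define f where "f n = (\<Prod>i<n. [:-r i, 1:])" for n
  have degf: "degree (f n) = n" for n unfolding f_def by (subst degree_prod_sum_eq) auto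
  have lead: "coeff (f n) n = 1" for n
    using lead_coeff_prod[of "\<lambda>i. [:-r i, 1:]" "{..<n}"] degf[of n] by (simp add: f_def)
  have "coeff (f (Suc n)) n = - (\<Sum>i<Suc n. r i)" for n
  proof (induction n)
    case (Suc n)
    have "f (Suc (Suc n)) = [:-r (Suc n), 1:] * f (Suc n)" by (simp add: f_def mult.commute)
    then show ?case using Suc lead[of "Suc n"] by (simp add: coeff_pCons)
  qed (simp add: f_def)
  moreover have "p = smult (lead_coeff p) (f (Suc n))"
    using r deg by (simp add: f_def root_list_def)
  then have "coeff p n = lead_coeff p * coeff (f (Suc n)) n" by (metis coeff_smult)
  ultimately show ?thesis by (simp del: sum.lessThan_Suc)
qed

text \<open>Each summand \<open>1 / (s - r)\<close> of the logarithmic derivative has negative imaginary part when \<open>r\<close> lies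
below \<open>s\<close>. This half-plane form of the Gauss--Lucas argument covers both real and strictly lower zeros.\<close>

lemma Im_log_derivative_neg:
  fixes p :: "complex poly"
  assumes "degree p > 0" and z: "\<And>z. poly p z = 0 \<Longrightarrow> Im z < Im s"
  shows "Im (poly (pderiv p) s / poly p s) < 0"
proof -
  obtain r where r: "root_list p r" by (rule root_list_exists)
  have "poly p s \<noteq> 0" using z by blast
  then have "Im (poly (pderiv p) s / poly p s) = (\<Sum>i<degree p. Im (1 / (s - r i)))"
    by (simp add: root_list_log_derivative[OF r] Im_sum)
  also have "\<dots> < (\<Sum>i<degree p. 0)"
  proof (rule sum_strict_mono)
    fix i assume "i \<in> {..<degree p}"
    then have "Im (r i) < Im s" using z root_list_root[OF r] by auto
    then show "Im (1 / (s - r i)) < 0"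
      by (auto simp: Im_divide divide_less_0_iff complex_eq_iff sum_power2_gt_zero_iff)
  qed (use assms(1) in auto)
  finally show ?thesis by simp
qed

lemma only_real_zeros_pderiv:
  assumes "only_real_zeros p"
  shows "only_real_zeros (pderiv p)"
proof (cases "degree p = 0")
  case True
  then show ?thesis by (metis only_real_zeros_0 pderiv_eq_0_iff)
next
  case False
  show ?thesis
  proof (rule only_real_zerosI)
    fix s :: complex assume "Im s > 0"
    with False have "Im (poly (pderiv (complex_poly p)) s / poly (complex_poly p) s) < 0"
      by (intro Im_log_derivative_neg) (auto dest: only_real_zerosD[OF assms, rotated])
    then show "poly (complex_poly (pderiv p)) s \<noteq> 0" by auto
  qed
qed

lemma only_real_zeros_higher_pderiv:
  "only_real_zeros p \<Longrightarrow> only_real_zeros ((pderiv ^^ n) p)"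
  by (induction n) (auto intro: only_real_zeros_pderiv)

text \<open>A real-rooted polynomial grows in modulus away from the real axis, because the distance to each of
its zeros does. Unlike real-rootedness, this inequality passes to limits for trivial reasons.\<close>

lemma only_real_zeros_modulus_mono:
  assumes "only_real_zeros p" "\<bar>y'\<bar> \<le> \<bar>y\<bar>"
  shows "cmod (poly (complex_poly p) (Complex x y')) \<le> cmod (poly (complex_poly p) (Complex x y))"
proof (cases "p = 0")
  case False
  let ?p = "complex_poly p"
  obtain r where r: "root_list ?p r" by (rule root_list_exists)
  have "Im (r i) = 0" if "i < degree p" for i
    using only_real_zerosD[OF assms(1)] root_list_root[OF r] that False by auto
  moreover have "y'\<^sup>2 \<le> y\<^sup>2" using assms(2) by (simp add: abs_le_square_iff)
  ultimately show ?thesis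
    unfolding root_list_poly[OF r] norm_mult prod_norm[symmetric]
    by (intro mult_left_mono prod_mono) (auto simp: cmod_def)
qed auto

text \<open>If the limit has a zero above the real axis, the inequality above forces it to vanish on
the whole vertical segment below that zero.\<close>

lemma only_real_zeros_limit:
  assumes real: "\<And>k. only_real_zeros (f k)"
    and lim: "\<And>z. (\<lambda>k. poly (complex_poly (f k)) z) \<longlonglongrightarrow> poly (complex_poly p) z"
  shows "only_real_zeros p"
proof (cases "p = 0")
  case False
  have mono: "cmod (poly (complex_poly p) (Complex x y')) \<le> cmod (poly (complex_poly p) (Complex x y))"
    if "\<bar>y'\<bar> \<le> \<bar>y\<bar>" for x y y'
    by (rule LIMSEQ_le[OF tendsto_norm[OF lim] tendsto_norm[OF lim]])
      (use only_real_zeros_modulus_mono[OF real that] in blast)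
  show ?thesis
  proof (rule only_real_zerosI)
    fix z assume z: "Im z > 0"
    show "poly (complex_poly p) z \<noteq> 0"
    proof
      assume z0: "poly (complex_poly p) z = 0"
      have "(\<lambda>y. Complex (Re z) y) ` {0..Im z} \<subseteq> {w. poly (complex_poly p) w = 0}"
        using mono[of _ "Im z" "Re z"] z0 z by auto
      moreover have "infinite ((\<lambda>y. Complex (Re z) y) ` {0..Im z})"
        using z by (subst finite_image_iff) (auto simp: inj_on_def)
      ultimately have "infinite {w. poly (complex_poly p) w = 0}" using finite_subset by blast
      then show False using poly_roots_finite[of "complex_poly p"] False by simp
    qed
  qed
qed auto

text \<open>On the imaginary axis an even polynomial is a real polynomial in the height. It has no zero there
off the origin, so it has the sign of its leading term down to height 0.\<close>

lemma even_real_rooted_coeff_sign: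
  assumes real: "only_real_zeros p" and even: "\<And>k. odd k \<Longrightarrow> coeff p k = 0"
    and deg: "degree p \<le> 2 * m"
  shows "(-1) ^ m * coeff p (2 * m) * coeff p 0 \<ge> 0"
proof -
  have *: "(-1) ^ m * coeff p 0 \<ge> 0"
    if real: "only_real_zeros p" and even: "\<And>k. odd k \<Longrightarrow> coeff p k = 0"
      and deg: "degree p \<le> 2 * m" and pos: "coeff p (2 * m) > 0" for p
  proof -
    define f where "f = (\<Sum>i\<le>m. monom ((-1) ^ (m + i) * coeff p (2 * i)) (2 * i))"
    have "degree f \<le> 2 * m"
      unfolding f_def by (intro degree_sum_le) (auto intro: order_trans[OF degree_monom_le])
    moreover have lead: "coeff f (2 * m) = coeff p (2 * m)"
      by (simp add: f_def coeff_sum coeff_monom)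
    ultimately have "degree f = 2 * m" using pos by (metis le_antisym le_degree less_irrefl)
    have "p \<noteq> 0" using pos by auto
    \<comment> \<open>Only even powers survive, and each square of the imaginary unit contributes a sign.\<close>
    have f_at: "poly (complex_poly p) (\<i> * of_real y) = of_real ((-1) ^ m * poly f y)" for y
    proof -
      have "poly (complex_poly p) (\<i> * of_real y) =
          (\<Sum>k\<in>{..2 * m}. of_real (coeff p k) * (\<i> * of_real y) ^ k)"
        unfolding poly_altdef using deg
        by (intro sum.mono_neutral_cong_left) (auto simp: coeff_map_poly coeff_eq_0)
      also have "\<dots> = (\<Sum>k\<in>(\<lambda>i. 2 * i) ` {..m}. of_real (coeff p k) * (\<i> * of_real y) ^ k)"
      proof (intro sum.mono_neutral_right)
        show "\<forall>k\<in>{..2 * m} - (\<lambda>i. 2 * i) ` {..m}. of_real (coeff p k) * (\<i> * of_real y) ^ k = 0"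
        proof
          fix k assume k: "k \<in> {..2 * m} - (\<lambda>i. 2 * i) ` {..m}"
          have "odd k"
          proof
            assume "even k"
            then obtain i where "k = 2 * i" by (elim evenE)
            then show False using k by auto
          qed
          then show "of_real (coeff p k) * (\<i> * of_real y) ^ k = 0" using even by simp
        qed
      qed auto
      also have "\<dots> = (\<Sum>i\<le>m. of_real (coeff p (2 * i)) * (\<i> * of_real y) ^ (2 * i))"
        by (subst sum.reindex) (auto simp: inj_on_def)
      also have "\<dots> = (\<Sum>i\<le>m. of_real ((-1) ^ m * ((-1) ^ (m + i) * coeff p (2 * i) * y ^ (2 * i))))"
      proof (intro sum.cong refl)
        fix i
        have "(\<i> * of_real y) ^ (2 * i) = of_real ((-1) ^ i * y ^ (2 * i))"
          by (simp only: power_mult power_mult_distrib power2_i) simp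
        moreover have "(-1) ^ m * ((-1) ^ (m + i) * coeff p (2 * i) * y ^ (2 * i)) =
            coeff p (2 * i) * ((-1) ^ i * y ^ (2 * i))"
          by (simp add: power_add flip: mult.assoc power_mult_distrib)
        ultimately show "of_real (coeff p (2 * i)) * (\<i> * of_real y) ^ (2 * i) =
            of_real ((-1) ^ m * ((-1) ^ (m + i) * coeff p (2 * i) * y ^ (2 * i)))"
          by (simp only: of_real_mult)
      qed
      also have "\<dots> = of_real ((-1) ^ m * poly f y)"
        by (simp add: f_def poly_sum poly_monom sum_distrib_left)
      finally show ?thesis .
    qed
    have f_nz: "poly f y \<noteq> 0" if "y > 0" for y
    proof
      assume "poly f y = 0"
      then have "poly (complex_poly p) (\<i> * of_real y) = 0" by (simp add: f_at)
      from only_real_zerosD[OF real \<open>p \<noteq> 0\<close> this] that show False by simp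
    qed
    have "poly f 0 \<ge> 0"
    proof (rule ccontr)
      assume "\<not> poly f 0 \<ge> 0"
      then have neg: "poly f 0 < 0" by simp
      have "lead_coeff f > 0" using lead pos \<open>degree f = 2 * m\<close> by simp
      then obtain b where b: "\<And>x. x \<ge> b \<Longrightarrow> poly f x \<ge> lead_coeff f"
        using poly_pinfty_gt_lc by blast
      have "poly f (max b 1) > 0" using b[of "max b 1"] \<open>lead_coeff f > 0\<close> by linarith
      moreover have "0 < max b 1" by (simp add: less_max_iff_disj)
      ultimately obtain x where "x > 0" "poly f x = 0" using poly_IVT_pos neg by blast
      then show False using f_nz by blast
    qed
    also have "poly f 0 = (-1) ^ m * coeff p 0"
      by (simp add: f_def poly_sum poly_monom sum.atMost_shift)
    finally show ?thesis .
  qed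
  consider "coeff p (2 * m) = 0" | "coeff p (2 * m) > 0" | "coeff p (2 * m) < 0" by linarith
  then show ?thesis
  proof cases
    case 2
    then have "coeff p (2 * m) * ((-1) ^ m * coeff p 0) \<ge> 0"
      using *[OF real even deg] by (intro mult_nonneg_nonneg[of "coeff p (2 * m)"]) auto
    then show ?thesis by (simp only: mult_ac)
  next
    case 3
    have "only_real_zeros (- p)" using real only_real_zeros_smult_iff[of "- 1" p] by simp
    then have "(-1) ^ m * coeff (- p) 0 \<ge> 0" using even deg 3 by (intro *) auto
    then have "- coeff p (2 * m) * ((-1) ^ m * coeff (- p) 0) \<ge> 0"
      using 3 by (intro mult_nonneg_nonneg[of "- coeff p (2 * m)"]) auto
    then show ?thesis by (simp add: mult_ac)
  qed simp
qed

lemma quadratic_discriminant_nonneg: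
  assumes "only_real_zeros [:a, 2 * b, c:]"
  shows "a * c \<le> b\<^sup>2"
proof (rule ccontr)
  assume "\<not> a * c \<le> b\<^sup>2"
  then have d: "a * c - b\<^sup>2 > 0" by simp
  then have "c \<noteq> 0" by (auto simp: not_le)
  define z where "z = Complex (- b / c) (sqrt (a * c - b\<^sup>2) / c)"
  have "(sqrt (a * c - b\<^sup>2))\<^sup>2 = a * c - b\<^sup>2" using d by simp
  then have "poly (complex_poly [:a, 2 * b, c:]) z = 0"
    using \<open>c \<noteq> 0\<close> by (simp add: z_def complex_eq_iff field_simps power2_eq_square)
  moreover have "Im z \<noteq> 0" using d \<open>c \<noteq> 0\<close> by (simp add: z_def)
  ultimately show False using only_real_zerosD[OF assms] \<open>c \<noteq> 0\<close> by auto
qed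

text \<open>Some \<open>m\<close>-th root of the real number \<open>- a / b\<close> has argument \<open>\<pi> / m\<close> or \<open>2\<pi> / m\<close>.\<close>

lemma binomial_not_real_rooted:
  assumes "m \<ge> 3" "a \<noteq> 0" "b \<noteq> 0"
  shows "\<not> only_real_zeros ([:a:] + monom b m)"
proof
  assume real: "only_real_zeros ([:a:] + monom b m)"
  define w where "w = - a / b"
  define t where "t = (if w < 0 then pi else 2 * pi) / real m"
  define z where "z = of_real (root m \<bar>w\<bar>) * cis t"
  have m: "m > 0" and w: "w \<noteq> 0" using assms by (auto simp: w_def)
  have "real m * t = (if w < 0 then pi else 2 * pi)" using m by (simp add: t_def)
  then have "cis t ^ m = of_real (sgn w)"
    using w by (auto simp: Complex.DeMoivre complex_eq_iff sgn_if)
  moreover have "root m \<bar>w\<bar> ^ m = \<bar>w\<bar>" using m by (simp add: real_root_pow_pos2)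
  then have "(of_real (root m \<bar>w\<bar>) :: complex) ^ m = of_real \<bar>w\<bar>"
    by (metis of_real_power)
  ultimately have "z ^ m = of_real w"
    by (simp add: z_def power_mult_distrib flip: of_real_mult) (simp add: abs_mult_sgn mult.commute)
  then have "poly (complex_poly ([:a:] + monom b m)) z = 0"
    using assms by (simp add: poly_monom w_def)
  moreover have "[:a:] + monom b m \<noteq> 0"
  proof
    assume "[:a:] + monom b m = 0"
    then have "coeff ([:a:] + monom b m) 0 = 0" by simp
    then show False using assms by simp
  qed
  ultimately have "Im z = 0" using only_real_zerosD[OF real] by blast
  moreover have "0 < t" "t < pi" using assms(1) by (auto simp: t_def field_simps)
  then have "sin t > 0" by (rule sin_gt_zero)
  ultimately show False using m w by (simp add: z_def)
qed

section \<open>Polar derivatives and the theorems of Laguerre and Grace\<close>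

text \<open>The number \<open>n\<close> is a formal degree: a polynomial of degree \<open>d \<le> n\<close> is treated as having \<open>n - d\<close>
further zeros at infinity.\<close>

definition polar_derivative :: "nat \<Rightarrow> 'a \<Rightarrow> 'a :: {idom, ring_char_0} poly \<Rightarrow> 'a poly" where
  "polar_derivative n u p = smult (of_nat n) p - [:-u, 1:] * pderiv p"

lemma Im_harmonic_difference:
  fixes a b :: complex
  shows "Im (a * b / (a - b)) = ((cmod a)\<^sup>2 * Im b - (cmod b)\<^sup>2 * Im a) / (cmod (a - b))\<^sup>2"
proof -
  have "Im (a * b) * Re (a - b) - Re (a * b) * Im (a - b)
      = ((Re a)\<^sup>2 + (Im a)\<^sup>2) * Im b - ((Re b)\<^sup>2 + (Im b)\<^sup>2) * Im a"
    by (simp add: algebra_simps power2_eq_square)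
  then show ?thesis by (simp only: Im_divide cmod_power2)
qed

text \<open>Multiplied by \<open>s - u\<close>, the quotient of the polar derivative by \<open>p\<close> becomes a sum over the zeros \<open>r\<close>
of the terms \<open>- (s - u)(r - u) / (s - r)\<close>, up to a multiple of \<open>s - u\<close> for the zeros at infinity.
With \<open>u\<close> real, the imaginary part of each term is the displayed fraction, whose sign can be read off
from the half-planes that contain \<open>r\<close> and \<open>s\<close>.\<close>

lemma Im_polar_derivative:
  fixes p :: "complex poly" and u :: real and s :: complex and r :: "nat \<Rightarrow> complex"
  assumes r: "root_list p r" and s: "poly p s \<noteq> 0"
  shows "Im ((s - u) * (poly (polar_derivative n u p) s / poly p s)) =
    (real n - real (degree p)) * Im s +
    (\<Sum>i<degree p. ((cmod (r i - u))\<^sup>2 * Im s - (cmod (s - u))\<^sup>2 * Im (r i)) / (cmod (s - r i))\<^sup>2)"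
proof -
  have "poly (polar_derivative n u p) s / poly p s
      = of_nat n - (s - u) * (poly (pderiv p) s / poly p s)"
    using s by (simp add: polar_derivative_def field_simps)
  also have "(s - u) * \<dots> = of_nat n * (s - u) - (\<Sum>i<degree p. (s - u)\<^sup>2 / (s - r i))"
    unfolding root_list_log_derivative[OF r s]
    by (simp add: algebra_simps power2_eq_square sum_distrib_left sum_subtractf)
  also have "\<dots> = (of_nat n - of_nat (degree p)) * (s - u)
      + (\<Sum>i<degree p. (s - u) - (s - u)\<^sup>2 / (s - r i))"
    by (simp add: sum_subtractf left_diff_distrib)
  also have "Im \<dots> = (real n - real (degree p)) * Im s
      + (\<Sum>i<degree p. Im ((s - u) - (s - u)\<^sup>2 / (s - r i)))"
    by (simp add: Im_sum)
  also have "(\<Sum>i<degree p. Im ((s - u) - (s - u)\<^sup>2 / (s - r i))) =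
    (\<Sum>i<degree p. ((cmod (r i - u))\<^sup>2 * Im s - (cmod (s - u))\<^sup>2 * Im (r i)) / (cmod (s - r i))\<^sup>2)"
  proof (intro sum.cong refl)
    fix i assume "i \<in> {..<degree p}"
    then have ne: "s \<noteq> r i" using root_list_root[OF r] s by auto
    then have "(s - u) - (s - u)\<^sup>2 / (s - r i) = - ((s - u) * (r i - u) / (s - r i))"
      by (simp add: field_simps power2_eq_square)
    moreover have "Im ((s - u) * (r i - u) / (s - r i)) =
      ((cmod (s - u))\<^sup>2 * Im (r i) - (cmod (r i - u))\<^sup>2 * Im s) / (cmod (s - r i))\<^sup>2"
      using Im_harmonic_difference[of "s - u" "r i - u"] by simp
    ultimately show "Im ((s - u) - (s - u)\<^sup>2 / (s - r i)) =
      ((cmod (r i - u))\<^sup>2 * Im s - (cmod (s - u))\<^sup>2 * Im (r i)) / (cmod (s - r i))\<^sup>2"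
      by (simp add: diff_divide_distrib)
  qed
  finally show ?thesis .
qed

lemma complex_poly_polar_derivative:
  "complex_poly (polar_derivative n u p) = polar_derivative n (of_real u) (complex_poly p)"
  by (simp add: polar_derivative_def)

text \<open>For \<open>s\<close> above the real axis all terms of the imaginary part are nonnegative. They all
vanish only if every zero is equal to \<open>u\<close> and none is at infinity; then the polar derivative is zero.\<close>

lemma only_real_zeros_polar_derivative:
  assumes "only_real_zeros p" "degree p \<le> n"
  shows "only_real_zeros (polar_derivative n u p)"
proof (cases "p = 0 \<or> polar_derivative n u p = 0")
  case True
  then show ?thesis by (auto simp: polar_derivative_def)
next
  case False
  let ?p = "complex_poly p"
  obtain r where r: "root_list ?p r" by (rule root_list_exists)
  have rr: "Im (r i) = 0" if "i < degree p" for i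
    using only_real_zerosD[OF assms(1)] root_list_root[OF r] that False by auto
  show ?thesis
  proof (rule only_real_zerosI)
    fix s :: complex assume s: "Im s > 0"
    then have ps: "poly ?p s \<noteq> 0" using only_real_zerosD[OF assms(1)] False by force
    show "poly (complex_poly (polar_derivative n u p)) s \<noteq> 0"
    proof
      assume "poly (complex_poly (polar_derivative n u p)) s = 0"
      then have "(real n - real (degree p)) * Im s +
        (\<Sum>i<degree p. (cmod (r i - u))\<^sup>2 * Im s / (cmod (s - r i))\<^sup>2) = 0"
        using Im_polar_derivative[OF r ps, of u n] by (simp add: complex_poly_polar_derivative rr)
      moreover have "(real n - real (degree p)) * Im s \<ge> 0" using assms(2) s by simp
      moreover have "(\<Sum>i<degree p. (cmod (r i - u))\<^sup>2 * Im s / (cmod (s - r i))\<^sup>2) \<ge> 0"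
        using s by (intro sum_nonneg) auto
      ultimately have n: "(real n - real (degree p)) * Im s = 0"
        and sum0: "(\<Sum>i<degree p. (cmod (r i - u))\<^sup>2 * Im s / (cmod (s - r i))\<^sup>2) = 0" by linarith+
      have n: "n = degree p" using n s by simp
      have "(cmod (r i - u))\<^sup>2 * Im s / (cmod (s - r i))\<^sup>2 = 0" if "i < degree p" for i
        using sum0 that s by (subst (asm) sum_nonneg_eq_0_iff) auto
      moreover have "s \<noteq> r i" if "i < degree p" for i using rr[OF that] s by auto
      ultimately have ru: "r i = u" if "i < degree p" for i
        using that s by (metis cmod_power2 divide_eq_0_iff eq_iff_diff_eq_0 less_irrefl
            mult_eq_0_iff norm_eq_zero power_eq_0_iff)
      have "?p = smult (lead_coeff ?p) ([:-of_real u, 1:] ^ n)"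
        using r ru n by (simp add: root_list_def)
      also have "\<dots> = complex_poly (smult (lead_coeff p) ([:-u, 1:] ^ n))"
        by (simp add: coeff_map_poly)
      finally have "complex_poly (p - smult (lead_coeff p) ([:-u, 1:] ^ n)) = 0"
        by (simp only: complex_poly_diff right_minus_eq)
      then have "p = smult (lead_coeff p) ([:-u, 1:] ^ n)"
        by (simp only: complex_poly_eq_0_iff)
      then obtain c where c: "p = smult c ([:-u, 1:] ^ n)" by blast
      have "poly (polar_derivative n u p) x = 0" for x
        unfolding polar_derivative_def c
        by (cases n) (simp_all add: pderiv_smult pderiv_power_Suc pderiv_pCons poly_power
            del: power_Suc mult_pCons_left mult_pCons_right, simp add: algebra_simps)
      then have "polar_derivative n u p = 0" using poly_all_0_iff_0 by blast
      then show False using False by simp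
    qed
  qed
qed

text \<open>Laguerre's theorem for a half-plane whose boundary contains the pole \<open>u\<close>. The degree drops by
exactly one since the new leading coefficient is a multiple of the sum of the \<open>u - r\<close> over the zeros
\<open>r\<close>, and this sum has positive imaginary part.\<close>

lemma polar_derivative_lower_half_plane:
  fixes p :: "complex poly" and u :: real
  assumes deg: "degree p = Suc n" and lower: "\<And>z. poly p z = 0 \<Longrightarrow> Im z < 0"
  shows "degree (polar_derivative (Suc n) u p) = n"
    and "\<And>s. poly (polar_derivative (Suc n) u p) s = 0 \<Longrightarrow> Im s < 0"
proof -
  let ?q = "polar_derivative (Suc n) u p"
  have "p \<noteq> 0" using deg by auto
  show "Im s < 0" if q: "poly ?q s = 0" for s :: complex
  proof (rule ccontr)
    assume s: "\<not> Im s < 0"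
    then have ps: "poly p s \<noteq> 0" using lower by blast
    obtain r where r: "root_list p r" by (rule root_list_exists)
    have "s \<noteq> u"
    proof
      assume "s = u"
      then have "poly ?q s = of_nat (Suc n) * poly p s" by (simp add: polar_derivative_def)
      then show False using q ps by (metis mult_eq_0_iff of_nat_eq_0_iff nat.distinct(2))
    qed
    have "0 < (\<Sum>i<degree p. ((cmod (r i - u))\<^sup>2 * Im s - (cmod (s - u))\<^sup>2 * Im (r i)) / (cmod (s - r i))\<^sup>2)"
    proof (rule sum_pos)
      fix i assume "i \<in> {..<degree p}"
      then have i: "Im (r i) < 0" using root_list_root[OF r] lower by auto
      then have "s \<noteq> r i" using s by auto
      moreover have "(cmod (s - u))\<^sup>2 * Im (r i) < 0" using \<open>s \<noteq> u\<close> i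
        by (simp add: mult_less_0_iff)
      moreover have "(cmod (r i - u))\<^sup>2 * Im s \<ge> 0" using s by simp
      ultimately show "((cmod (r i - u))\<^sup>2 * Im s - (cmod (s - u))\<^sup>2 * Im (r i)) / (cmod (s - r i))\<^sup>2 > 0"
        by (intro divide_pos_pos) auto
    qed (use deg in \<open>auto simp: lessThan_empty_iff\<close>)
    then show False using Im_polar_derivative[OF r ps, of u "Suc n"] q deg by simp
  qed
  obtain r where r: "root_list p r" by (rule root_list_exists)
  have coeff: "coeff ?q k = (of_nat (Suc n) - of_nat k) * coeff p k + u * of_nat (Suc k) * coeff p (Suc k)" for k
    unfolding polar_derivative_def
    by (cases k) (simp_all add: coeff_pderiv coeff_pCons algebra_simps)
  have "coeff ?q n = lead_coeff p * (\<Sum>i<degree p. u - r i)"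
    using root_list_sum[OF r deg] deg
    by (simp add: coeff sum_subtractf del: sum.lessThan_Suc) (simp add: algebra_simps del: sum.lessThan_Suc)
  moreover have "Im (\<Sum>i<degree p. u - r i) > 0"
    unfolding Im_sum using root_list_root[OF r] lower deg by (intro sum_pos) (auto simp: lessThan_empty_iff)
  then have "(\<Sum>i<degree p. u - r i) \<noteq> 0" by (metis less_irrefl zero_complex.simps(2))
  ultimately have "coeff ?q n \<noteq> 0" using \<open>p \<noteq> 0\<close> by simp
  moreover have "degree ?q \<le> n"
  proof (rule degree_le, intro allI impI)
    fix k assume "n < k"
    then show "coeff ?q k = 0" using deg by (cases "k = Suc n") (auto simp: coeff coeff_eq_0)
  qed
  ultimately show "degree ?q = n" by (simp add: le_antisym le_degree)
qed

lemma pderiv_lower_half_plane: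
  fixes p :: "complex poly"
  assumes "degree p = Suc n" and lower: "\<And>z. poly p z = 0 \<Longrightarrow> Im z < 0"
  shows "poly (pderiv p) s = 0 \<Longrightarrow> Im s < 0"
proof (rule ccontr)
  assume q: "poly (pderiv p) s = 0" and s: "\<not> Im s < 0"
  have "Im (poly (pderiv p) s / poly p s) < 0"
    by (rule Im_log_derivative_neg) (use assms s in \<open>auto dest!: lower\<close>)
  then show False using q by simp
qed

text \<open>The sum is the apolar pairing of \<open>g\<close> and \<open>p\<close>, both regarded as polynomials of degree \<open>n\<close>. Splitting
off a real linear factor of \<open>g\<close> replaces \<open>p\<close> by a polar derivative with real pole (or by the ordinary
derivative when the factor is \<open>x\<close>), which again has all its zeros in the open lower half-plane, and
lowers \<open>n\<close> by one.\<close>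

lemma grace_nonvanishing:
  fixes g :: "real poly" and p :: "complex poly"
  assumes "only_real_zeros g" "g \<noteq> 0" "degree g \<le> n"
    and "degree p = n" "\<And>z. poly p z = 0 \<Longrightarrow> Im z < 0" "p \<noteq> 0"
  shows "(\<Sum>k\<le>n. of_real (coeff g k) * coeff p k / of_nat (n choose k)) \<noteq> 0"
  using assms
proof (induction n arbitrary: g p)
  case 0
  then obtain a b where "g = [:a:]" "p = [:b:]" by (metis degree_eq_zeroE le_zero_eq)
  then show ?case using 0 by simp
next
  case (Suc n)
  have choose1: "1 / of_nat (Suc n choose k) = (of_nat (Suc n) - of_nat k) / (of_nat (Suc n) * of_nat (n choose k) :: complex)"
    if "k \<le> n" for k
  proof -
    have "of_nat ((Suc n - k) * (Suc n choose k)) = (of_nat (Suc n * (n choose k)) :: complex)"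
      using binomial_absorb_comp[of "Suc n" k] by simp
    then have *: "(of_nat (Suc n) - of_nat k) * of_nat (Suc n choose k) = (of_nat (Suc n) * of_nat (n choose k) :: complex)"
      using that by (simp only: of_nat_mult of_nat_diff[OF le_SucI[OF that]])
    have "of_nat (n choose k) \<noteq> (0::complex)" "of_nat (Suc n choose k) \<noteq> (0::complex)"
      using that by (auto simp del: binomial_Suc_Suc)
    then show ?thesis using * by (simp add: divide_simps del: of_nat_Suc binomial_Suc_Suc)
  qed
  have choose2: "1 / of_nat (Suc n choose Suc k) = of_nat (Suc k) / (of_nat (Suc n) * of_nat (n choose k) :: complex)"
    if "k \<le> n" for k
  proof -
    have "of_nat (Suc k * (Suc n choose Suc k)) = (of_nat (Suc n * (n choose k)) :: complex)"
      by (simp only: Suc_times_binomial_eq mult.commute)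
    then have *: "of_nat (Suc k) * of_nat (Suc n choose Suc k) = (of_nat (Suc n) * of_nat (n choose k) :: complex)"
      by (simp only: of_nat_mult)
    have "of_nat (n choose k) \<noteq> (0::complex)" "of_nat (Suc n choose Suc k) \<noteq> (0::complex)"
      using that by (auto simp del: binomial_Suc_Suc)
    then show ?thesis using * by (simp add: divide_simps del: of_nat_Suc binomial_Suc_Suc)
  qed
  have step: "(\<Sum>k\<le>Suc n. of_real (coeff ([:v, u:] * h) k) * coeff p k / of_nat (Suc n choose k)) =
      (\<Sum>k\<le>n. of_real (coeff h k) * coeff q k / of_nat (n choose k)) / of_nat (Suc n)"
    if "degree h \<le> n" and
      q: "\<And>k. coeff q k = v * (of_nat (Suc n) - of_nat k) * coeff p k + u * of_nat (Suc k) * coeff p (Suc k)"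
    for v u :: real and h q
  proof -
    have "(\<Sum>k\<le>Suc n. of_real (coeff ([:v, u:] * h) k) * coeff p k / of_nat (Suc n choose k)) =
       (\<Sum>k\<le>Suc n. of_real (v * coeff h k) * coeff p k / of_nat (Suc n choose k)) +
       (\<Sum>k\<le>Suc n. of_real (u * coeff (pCons 0 h) k) * coeff p k / of_nat (Suc n choose k))"
      unfolding sum.distrib[symmetric]
      by (intro sum.cong) (auto simp: coeff_pCons field_simps split: nat.splits)
    also have "(\<Sum>k\<le>Suc n. of_real (v * coeff h k) * coeff p k / of_nat (Suc n choose k)) =
       (\<Sum>k\<le>n. of_real (v * coeff h k) * coeff p k * (1 / of_nat (Suc n choose k)))"
      using that(1) by (simp add: coeff_eq_0 del: binomial_Suc_Suc)
    also have "\<dots> = (\<Sum>k\<le>n. of_real (v * coeff h k) * coeff p k *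
        ((of_nat (Suc n) - of_nat k) / (of_nat (Suc n) * of_nat (n choose k))))"
      using choose1 by (intro sum.cong) auto
    also have "(\<Sum>k\<le>Suc n. of_real (u * coeff (pCons 0 h) k) * coeff p k / of_nat (Suc n choose k)) =
       (\<Sum>k\<le>n. of_real (u * coeff h k) * coeff p (Suc k) * (1 / of_nat (Suc n choose Suc k)))"
      by (subst sum.atMost_Suc_shift) (simp del: binomial_Suc_Suc)
    also have "\<dots> = (\<Sum>k\<le>n. of_real (u * coeff h k) * coeff p (Suc k) *
        (of_nat (Suc k) / (of_nat (Suc n) * of_nat (n choose k))))"
      using choose2 by (intro sum.cong) auto
    finally show ?thesis
      unfolding sum.distrib[symmetric] sum_divide_distrib
      by (rule trans) (intro sum.cong refl, simp add: q field_simps del: of_nat_Suc)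
  qed
  have coeff_polar: "coeff (polar_derivative (Suc n) w p) k =
      (of_nat (Suc n) - of_nat k) * coeff p k + w * of_nat (Suc k) * coeff p (Suc k)" for k and w
    unfolding polar_derivative_def
    by (cases k) (simp_all add: coeff_pderiv coeff_pCons algebra_simps)
  have nonzero: "(\<Sum>k\<le>Suc n. of_real (coeff ([:v, u:] * h) k) * coeff p k / of_nat (Suc n choose k)) \<noteq> 0"
    if "degree h \<le> n" "h \<noteq> 0" "only_real_zeros h" "v \<noteq> 0 \<or> u \<noteq> 0" for v u :: real and h
  proof (cases "v = 0")
    case True
    let ?q = "smult (of_real u) (pderiv p)"
    have "u \<noteq> 0" using True that by simp
    then have "degree ?q = n" "?q \<noteq> 0"
      using Suc.prems(4) by (auto simp: degree_pderiv pderiv_eq_0_iff)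
    moreover have "Im z < 0" if "poly ?q z = 0" for z
      using pderiv_lower_half_plane[OF Suc.prems(4,5)] that \<open>u \<noteq> 0\<close> by auto
    ultimately have "(\<Sum>k\<le>n. of_real (coeff h k) * coeff ?q k / of_nat (n choose k)) \<noteq> 0"
      using that by (intro Suc.IH) auto
    then show ?thesis
      using that(1) True by (subst step[where q = ?q]) (auto simp: coeff_pderiv simp del: of_nat_Suc)
  next
    case False
    let ?q = "smult (of_real v) (polar_derivative (Suc n) (of_real (u / v)) p)"
    note polar = polar_derivative_lower_half_plane[OF Suc.prems(4,5), of "u / v"]
    have "degree ?q = n" using polar(1) False by simp
    moreover have "Im z < 0" if "poly ?q z = 0" for z using polar(2) that False by auto
    moreover from this[of 0] have "?q \<noteq> 0" by force
    ultimately have "(\<Sum>k\<le>n. of_real (coeff h k) * coeff ?q k / of_nat (n choose k)) \<noteq> 0"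
      using that by (intro Suc.IH) auto
    then show ?thesis
      using that(1) False
      by (subst step[where q = ?q]) (auto simp: coeff_polar algebra_simps simp del: of_nat_Suc)
  qed
  show ?case
  proof (cases "degree g = 0")
    case True
    \<comment> \<open>The constant polynomial 1 serves as the linear factor here: it stands for a zero of \<open>g\<close> at infinity.\<close>
    then show ?thesis using nonzero[of g 1 0] Suc.prems by simp
  next
    case False
    then have "\<not> constant (poly (complex_poly g))" by (simp add: constant_degree)
    then obtain z where z: "poly (complex_poly g) z = 0" using fundamental_theorem_of_algebra by blast
    then have "Im z = 0" using only_real_zerosD Suc.prems by blast
    then have "z = of_real (Re z)" by (simp add: complex_eq_iff)
    then have "poly g (Re z) = 0" using z by (metis of_real_eq_0_iff poly_complex_poly_of_real)
    then obtain h where h: "g = [:- Re z, 1:] * h" using poly_eq_0_iff_dvd by blast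
    then have "h \<noteq> 0" using Suc.prems by auto
    moreover from this have "degree h \<le> n" 
      using Suc.prems(3) unfolding h by (subst (asm) degree_mult_eq) auto
    moreover have "only_real_zeros h" using Suc.prems(1,2) h by (auto simp: only_real_zeros_def)
    ultimately show ?thesis using nonzero[of h "- Re z" 1] h by simp
  qed
qed

section \<open>The umbral functional of a sequence\<close>

text \<open>The linear functional with \<open>s^n \<mapsto> \<gamma>\<^sub>n\<close>. Operations on the sequence, such as shifts and differences,
become multiplications of the argument by polynomials.\<close>

definition umbral :: "(nat \<Rightarrow> 'a :: comm_ring_1) \<Rightarrow> 'a poly \<Rightarrow> 'a" where
  "umbral \<gamma> p = (\<Sum>k\<le>degree p. coeff p k * \<gamma> k)"

lemma umbral_cutoff:
  assumes "degree p \<le> n"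
  shows "umbral \<gamma> p = (\<Sum>k\<le>n. coeff p k * \<gamma> k)"
  unfolding umbral_def using assms
  by (intro sum.mono_neutral_left) (auto simp: coeff_eq_0)

lemma umbral_0 [simp]: "umbral \<gamma> 0 = 0"
  by (simp add: umbral_def)

lemma umbral_add: "umbral \<gamma> (p + q) = umbral \<gamma> p + umbral \<gamma> q"
proof -
  let ?n = "max (degree p) (degree q)"
  have "degree (p + q) \<le> ?n" "degree p \<le> ?n" "degree q \<le> ?n"
    by (auto intro: degree_add_le)
  then show ?thesis by (simp add: umbral_cutoff[of _ ?n] sum.distrib algebra_simps)
qed

lemma umbral_smult: "umbral \<gamma> (smult c p) = c * umbral \<gamma> p"
  using degree_smult_le[of c p]
  by (simp add: umbral_cutoff[of _ "degree p"] sum_distrib_left mult.assoc)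

lemma umbral_diff: "umbral \<gamma> (p - q) = umbral \<gamma> p - umbral \<gamma> q"
  using umbral_add[of \<gamma> p "- q"] umbral_smult[of \<gamma> "- 1" q] by simp

lemma umbral_sum: "umbral \<gamma> (sum f A) = (\<Sum>x\<in>A. umbral \<gamma> (f x))"
  by (induction A rule: infinite_finite_induct) (auto simp: umbral_add)

lemma umbral_monom: "umbral \<gamma> (monom c n) = c * \<gamma> n"
  using degree_monom_le[of c n] by (simp add: umbral_cutoff[of _ n] if_distrib[of "\<lambda>x. x * _"] cong: if_cong)

lemma umbral_pCons: "umbral \<gamma> (pCons a p) = a * \<gamma> 0 + umbral (\<lambda>n. \<gamma> (Suc n)) p"
  by (subst umbral_cutoff[OF degree_pCons_le]) (simp add: umbral_def sum.atMost_Suc_shift del: sum.atMost_Suc)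

lemma umbral_monom_mult: "umbral \<gamma> (monom 1 l * p) = umbral (\<lambda>n. \<gamma> (n + l)) p"
  by (induction l arbitrary: \<gamma>) (simp_all add: monom_Suc umbral_pCons)

lemma umbral_seq_diff: "umbral (\<lambda>n. \<gamma> n - \<delta> n) p = umbral \<gamma> p - umbral \<delta> p"
  by (simp add: umbral_def sum_subtractf algebra_simps)

lemma umbral_signed:
  "umbral (\<lambda>n. c * \<theta> ^ n * \<delta> n) p = c * umbral \<delta> (pcompose p [:0, \<theta>:])"
proof -
  have "degree (pcompose p [:0, \<theta>:]) \<le> degree p * degree [:0, \<theta>:]" by (rule degree_pcompose_le)
  also have "\<dots> \<le> degree p * 1" by (intro mult_le_mono) auto
  finally have "umbral \<delta> (pcompose p [:0, \<theta>:]) = (\<Sum>k\<le>degree p. coeff (pcompose p [:0, \<theta>:]) k * \<delta> k)"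
    by (intro umbral_cutoff) simp
  then show ?thesis
    by (simp add: umbral_def coeff_pcompose_linear sum_distrib_left mult_ac)
qed

lemma umbral_cong:
  assumes "\<And>k. k \<le> degree p \<Longrightarrow> \<gamma> k = \<delta> k"
  shows "umbral \<gamma> p = umbral \<delta> p"
  unfolding umbral_def using assms by (intro sum.cong) auto

lemma umbral_of_real:
  "umbral (\<lambda>n. of_real (g n)) (complex_poly p) = of_real (umbral g p)"
  by (simp add: umbral_def coeff_map_poly)

definition forward_difference :: "(nat \<Rightarrow> 'a :: comm_ring_1) \<Rightarrow> nat \<Rightarrow> 'a" where
  "forward_difference \<gamma> n = \<gamma> (Suc n) - \<gamma> n"

lemma umbral_forward_difference: "umbral \<gamma> ([:-1, 1:] ^ m * p) = umbral ((forward_difference ^^ m) \<gamma>) p"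
proof (induction m arbitrary: p)
  case (Suc m)
  let ?g = "(forward_difference ^^ m) \<gamma>"
  have "umbral \<gamma> ([:-1, 1:] ^ Suc m * p) = umbral \<gamma> ([:-1, 1:] ^ m * ([:-1, 1:] * p))"
    by (simp only: power_Suc2 mult.assoc)
  also have "\<dots> = umbral ?g ([:-1, 1:] * p)" by (rule Suc.IH)
  also have "[:-1, 1:] * p = pCons 0 p - p" by simp
  also have "umbral ?g (pCons 0 p - p) = umbral (\<lambda>n. ?g (Suc n) - ?g n) p"
    by (simp add: umbral_diff umbral_pCons umbral_seq_diff)
  finally show ?case by (simp add: forward_difference_def[abs_def])
qed simp

section \<open>Jensen polynomials\<close>

definition jensen_poly :: "(nat \<Rightarrow> real) \<Rightarrow> nat \<Rightarrow> real poly" where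
  "jensen_poly \<gamma> n = (\<Sum>k\<le>n. monom (of_nat (n choose k) * \<gamma> k) k)"

definition jensen_real_rooted :: "(nat \<Rightarrow> real) \<Rightarrow> bool" where
  "jensen_real_rooted \<gamma> \<longleftrightarrow> (\<forall>n. only_real_zeros (jensen_poly \<gamma> n))"

lemma coeff_jensen_poly: "coeff (jensen_poly \<gamma> n) k = of_nat (n choose k) * \<gamma> k"
  by (simp add: jensen_poly_def coeff_sum if_distrib binomial_eq_0 cong: if_cong)

lemma degree_jensen_poly: "degree (jensen_poly \<gamma> n) \<le> n"
  by (rule degree_le) (simp add: coeff_jensen_poly binomial_eq_0)

text \<open>The shifted sequence has the derivatives as its Jensen polynomials, up to constants.\<close>

lemma jensen_real_rooted_shift:
  assumes "jensen_real_rooted \<gamma>"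
  shows "jensen_real_rooted (\<lambda>n. \<gamma> (n + l))"
proof -
  have step: "jensen_real_rooted (\<lambda>n. \<gamma> (Suc n))" if "jensen_real_rooted \<gamma>" for \<gamma>
    unfolding jensen_real_rooted_def
  proof
    fix n
    have "pderiv (jensen_poly \<gamma> (Suc n)) = smult (of_nat (Suc n)) (jensen_poly (\<lambda>n. \<gamma> (Suc n)) n)"
    proof (rule poly_eqI)
      fix k
      have "real (Suc k * (Suc n choose Suc k)) = real (Suc n * (n choose k))"
        by (simp only: Suc_times_binomial_eq mult.commute)
      then show "coeff (pderiv (jensen_poly \<gamma> (Suc n))) k =
          coeff (smult (of_nat (Suc n)) (jensen_poly (\<lambda>n. \<gamma> (Suc n)) n)) k"
        by (simp only: coeff_pderiv coeff_jensen_poly coeff_smult mult.assoc[symmetric] of_nat_mult)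
    qed
    moreover have "only_real_zeros (pderiv (jensen_poly \<gamma> (Suc n)))"
      using that by (simp add: jensen_real_rooted_def only_real_zeros_pderiv)
    ultimately show "only_real_zeros (jensen_poly (\<lambda>n. \<gamma> (Suc n)) n)"
      by (simp add: only_real_zeros_smult_iff)
  qed
  show ?thesis
  proof (induction l)
    case (Suc l)
    from step[OF this] show ?case by simp
  qed (use assms in simp)
qed

text \<open>The Jensen polynomials of the difference sequence are polar derivatives with pole \<open>-1\<close>, up to
constants.\<close>

lemma jensen_real_rooted_difference:
  assumes "jensen_real_rooted \<gamma>"
  shows "jensen_real_rooted ((forward_difference ^^ m) \<gamma>)"
proof -
  have step: "jensen_real_rooted (forward_difference \<gamma>)" if "jensen_real_rooted \<gamma>" for \<gamma>
    unfolding jensen_real_rooted_def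
  proof
    fix n
    have "polar_derivative (Suc n) (- 1) (jensen_poly \<gamma> (Suc n)) =
        smult (- of_nat (Suc n)) (jensen_poly (forward_difference \<gamma>) n)"
    proof (rule poly_eqI)
      fix k
      have 1: "real (Suc k) * real (Suc n choose Suc k) = real (Suc n) * real (n choose k)"
        by (metis Suc_times_binomial_eq mult.commute of_nat_mult)
      have 2: "(real (Suc n) - real k) * real (Suc n choose k) = real (Suc n) * real (n choose k)"
      proof (cases "k \<le> Suc n")
        case True
        then show ?thesis using binomial_absorb_comp[of "Suc n" k]
          by (metis diff_Suc_1 of_nat_diff of_nat_mult)
      qed (simp add: binomial_eq_0)
      have "coeff (polar_derivative (Suc n) (- 1) (jensen_poly \<gamma> (Suc n))) k =
          (real (Suc n) - real k) * (real (Suc n choose k) * \<gamma> k)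
          - real (Suc k) * (real (Suc n choose Suc k) * \<gamma> (Suc k))"
        unfolding polar_derivative_def
        by (cases k) (simp_all add: coeff_pderiv coeff_pCons coeff_jensen_poly algebra_simps
            del: binomial_Suc_Suc)
      also have "\<dots> = real (Suc n) * real (n choose k) * \<gamma> k - real (Suc n) * real (n choose k) * \<gamma> (Suc k)"
        by (simp only: mult.assoc[symmetric] 1 2)
      finally show "coeff (polar_derivative (Suc n) (- 1) (jensen_poly \<gamma> (Suc n))) k =
        coeff (smult (- of_nat (Suc n)) (jensen_poly (forward_difference \<gamma>) n)) k"
        by (simp add: coeff_jensen_poly forward_difference_def algebra_simps)
    qed
    moreover have "only_real_zeros (polar_derivative (Suc n) (- 1) (jensen_poly \<gamma> (Suc n)))"
      using that degree_jensen_poly[of \<gamma> "Suc n"]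
      by (intro only_real_zeros_polar_derivative) (auto simp: jensen_real_rooted_def)
    ultimately show "only_real_zeros (jensen_poly (forward_difference \<gamma>) n)"
      by (metis only_real_zeros_smult_iff neg_equal_0_iff_equal of_nat_eq_0_iff nat.distinct(2))
  qed
  show ?thesis by (induction m) (use assms step in auto)
qed

text \<open>This is the discriminant of a quadratic Jensen polynomial of a shifted sequence.\<close>

lemma jensen_log_concave:
  assumes "jensen_real_rooted \<gamma>"
  shows "\<gamma> k * \<gamma> (k + 2) \<le> (\<gamma> (k + 1))\<^sup>2"
proof -
  have "jensen_poly (\<lambda>n. \<gamma> (n + k)) 2 = [:\<gamma> k, 2 * \<gamma> (k + 1), \<gamma> (k + 2):]"
    by (simp add: jensen_poly_def numeral_2_eq_2 monom_Suc monom_0 add.commute)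
  then show ?thesis
    using jensen_real_rooted_shift[OF assms, of k] quadratic_discriminant_nonneg
    unfolding jensen_real_rooted_def by metis
qed

text \<open>Otherwise let \<open>m\<close> be the distance from \<open>i\<close> to the next nonzero term. Then the Jensen polynomial of
degree \<open>m\<close> of the sequence shifted by \<open>i\<close> is a binomial \<open>a + b x^m\<close>. The sign hypothesis excludes
\<open>m = 2\<close>, where such a binomial could have real zeros.\<close>

lemma jensen_no_gaps:
  assumes real: "jensen_real_rooted \<gamma>" and sign: "\<And>k. \<gamma> k * \<gamma> (k + 2) \<ge> 0"
    and "\<gamma> i \<noteq> 0" "\<gamma> (Suc i) = 0" "i < n"
  shows "\<gamma> n = 0"
proof (rule ccontr)
  assume "\<gamma> n \<noteq> 0"
  define \<delta> where "\<delta> = (\<lambda>n. \<gamma> (n + i))"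
  have \<delta>: "jensen_real_rooted \<delta>" unfolding \<delta>_def by (rule jensen_real_rooted_shift[OF real])
  define m where "m = (LEAST m. m > 0 \<and> \<delta> m \<noteq> 0)"
  have "n - i > 0 \<and> \<delta> (n - i) \<noteq> 0" using assms \<open>\<gamma> n \<noteq> 0\<close> by (simp add: \<delta>_def)
  then have m: "m > 0" "\<delta> m \<noteq> 0" unfolding m_def by (metis (mono_tags, lifting) LeastI)+
  have below: "\<delta> k = 0" if "k > 0" "k < m" for k
    using that not_less_Least unfolding m_def by blast
  have "\<delta> 0 \<noteq> 0" "\<delta> 1 = 0" using assms by (auto simp: \<delta>_def)
  have "m \<noteq> 1" using m \<open>\<delta> 1 = 0\<close> by auto
  moreover have "m \<noteq> 2"
  proof
    assume "m = 2"
    have "\<delta> 0 * \<delta> 2 \<le> 0"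
      using jensen_log_concave[OF \<delta>, of 0] \<open>\<delta> 1 = 0\<close> by (simp add: numeral_2_eq_2)
    moreover have "\<delta> 0 * \<delta> 2 \<ge> 0" using sign[of i] by (simp add: \<delta>_def add.commute)
    ultimately show False using m \<open>m = 2\<close> \<open>\<delta> 0 \<noteq> 0\<close> by auto
  qed
  ultimately have "m \<ge> 3" using m by linarith
  moreover have "jensen_poly \<delta> m = [:\<delta> 0:] + monom (\<delta> m) m"
  proof (rule poly_eqI)
    fix k
    show "coeff (jensen_poly \<delta> m) k = coeff ([:\<delta> 0:] + monom (\<delta> m) m) k"
      using below[of k] m
      by (cases "k < m"; cases "k = m"; cases k) (auto simp: coeff_jensen_poly coeff_pCons)
  qed
  ultimately show False
    using \<delta> binomial_not_real_rooted[of m "\<delta> 0" "\<delta> m"] m \<open>\<delta> 0 \<noteq> 0\<close>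
    unfolding jensen_real_rooted_def by metis
qed

text \<open>Between \<open>i\<close> and \<open>n\<close> some nonzero term is directly followed by a zero.\<close>

lemma jensen_zero_persists:
  assumes real: "jensen_real_rooted \<gamma>" and sign: "\<And>k. \<gamma> k * \<gamma> (k + 2) \<ge> 0"
    and "\<gamma> i \<noteq> 0" "i < n" "\<gamma> n = 0" "n \<le> n'"
  shows "\<gamma> n' = 0"
proof -
  have "\<exists>j. j < n \<and> \<gamma> j \<noteq> 0 \<and> \<gamma> (Suc j) = 0"
  proof (rule ccontr)
    assume *: "\<not> ?thesis"
    have "i + j \<le> n \<Longrightarrow> \<gamma> (i + j) \<noteq> 0" for j
    proof (induction j)
      case (Suc j)
      then show ?case using *[unfolded not_ex, rule_format, of "i + j"] by simp
    qed (use \<open>\<gamma> i \<noteq> 0\<close> in simp)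
    from this[of "n - i"] show False using assms by simp
  qed
  then obtain j where j: "j < n" "\<gamma> j \<noteq> 0" "\<gamma> (Suc j) = 0" by blast
  show ?thesis
    by (rule jensen_no_gaps[OF real sign j(2,3)]) (use j(1) \<open>n \<le> n'\<close> in linarith)
qed

lemma sign_transfer:
  fixes e x y :: real
  assumes "e * e = 1" "x \<noteq> 0" "x = e * \<bar>x\<bar>" "0 \<le> x * y"
  shows "y = e * \<bar>y\<bar>"
proof -
  have "e = 1 \<or> e = -1" using assms(1) by (metis square_eq_1_iff)
  then show ?thesis
  proof
    assume e: "e = 1"
    then have "x \<ge> 0" using assms(3) by simp
    then have "x > 0" using assms(2) by simp
    then show ?thesis using assms(4) e by (simp add: zero_le_mult_iff)
  next
    assume e: "e = -1"
    then have "x \<le> 0" using assms(3)[unfolded e] by linarith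
    then have "x < 0" using assms(2) by simp
    then show ?thesis using assms(4) e by (simp add: zero_le_mult_iff)
  qed
qed

text \<open>There are no gaps, so the signs of the first two nonzero terms propagate in steps of two.\<close>

lemma jensen_sign_pattern:
  assumes real: "jensen_real_rooted \<gamma>" and sign: "\<And>k. \<gamma> k * \<gamma> (k + 2) \<ge> 0"
  obtains c \<theta> :: real where "c * c = 1" "\<theta> * \<theta> = 1" "\<And>n. \<gamma> n = c * \<theta> ^ n * \<bar>\<gamma> n\<bar>"
proof (cases "\<forall>n. \<gamma> n = 0")
  case True
  then show thesis using that[of 1 1] by simp
next
  case False
  define i where "i = (LEAST n. \<gamma> n \<noteq> 0)"
  have i: "\<gamma> i \<noteq> 0" using False unfolding i_def by (metis (mono_tags, lifting) LeastI)
  have below: "\<gamma> n = 0" if "n < i" for n using that not_less_Least unfolding i_def by blast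
  define c where "c = sgn (\<gamma> i)"
  define \<theta> where "\<theta> = (if \<gamma> (Suc i) = 0 then 1 else c * sgn (\<gamma> (Suc i)))"
  have c: "c * c = 1" using i by (auto simp: c_def sgn_if)
  have \<theta>: "\<theta> * \<theta> = 1" using i by (auto simp: \<theta>_def c_def sgn_if)
  have shifted: "\<gamma> (i + l) = c * \<theta> ^ l * \<bar>\<gamma> (i + l)\<bar>" for l
  proof (induction l rule: less_induct)
    case (less l)
    consider "l = 0" | "l = 1" | l' where "l = l' + 2"
      by (metis One_nat_def add_2_eq_Suc' not0_implies_Suc)
    then show ?case
    proof cases
      case 1
      then show ?thesis by (simp add: c_def sgn_mult_abs)
    next
      case 2
      have "c * \<theta> = (if \<gamma> (Suc i) = 0 then c else sgn (\<gamma> (Suc i)))"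
        using c by (simp add: \<theta>_def flip: mult.assoc)
      then show ?thesis using 2 by (simp add: sgn_mult_abs)
    next
      case 3
      have pow: "\<theta> ^ l = \<theta> ^ l'" using 3 \<theta> by (simp add: power_add power2_eq_square)
      define e where "e = c * \<theta> ^ l'"
      have e: "e * e = 1"
        using c \<theta> by (simp add: e_def power_mult_distrib flip: power2_eq_square)
          (simp add: power2_eq_square power_commutes flip: power_mult_distrib)
      show ?thesis
      proof (cases "\<gamma> (i + l') = 0")
        case True
        then have "l' \<noteq> 0" using i by (intro notI) simp
        have "\<gamma> (i + l) = 0"
          by (rule jensen_zero_persists[OF real sign i _ True]) (use 3 \<open>l' \<noteq> 0\<close> in auto)
        then show ?thesis by simp
      next
        case False
        have "\<gamma> (i + l') = e * \<bar>\<gamma> (i + l')\<bar>" unfolding e_def by (rule less) (use 3 in simp)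
        moreover have "0 \<le> \<gamma> (i + l') * \<gamma> (i + l)" using sign[of "i + l'"] 3 by simp
        ultimately have "\<gamma> (i + l) = e * \<bar>\<gamma> (i + l)\<bar>" by (rule sign_transfer[OF e False])
        then show ?thesis unfolding pow by (simp only: e_def)
      qed
    qed
  qed
  have above: "\<gamma> n = c * \<theta> ^ (n - i) * \<bar>\<gamma> n\<bar>" if "n \<ge> i" for n
    using shifted[of "n - i"] that by (simp only: le_add_diff_inverse)
  have "\<gamma> n = (c * \<theta> ^ i) * \<theta> ^ n * \<bar>\<gamma> n\<bar>" for n
  proof (cases "n < i")
    case False
    have "\<theta> ^ i * \<theta> ^ n = (\<theta> * \<theta>) ^ i * \<theta> ^ (n - i)"
      using False by (simp add: power_mult_distrib mult.assoc flip: power_add)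
    then have "\<theta> ^ i * \<theta> ^ n = \<theta> ^ (n - i)" using \<theta> by simp
    then have "(c * \<theta> ^ i) * \<theta> ^ n = c * \<theta> ^ (n - i)" by (simp add: mult.assoc)
    moreover have "\<gamma> n = c * \<theta> ^ (n - i) * \<bar>\<gamma> n\<bar>" using False by (intro above) simp
    ultimately show ?thesis by (simp only:)
  qed (simp add: below)
  moreover have "(c * \<theta> ^ i) * (c * \<theta> ^ i) = 1"
  proof -
    have "(c * \<theta> ^ i) * (c * \<theta> ^ i) = (c * c) * (\<theta> * \<theta>) ^ i"
      by (simp add: power_mult_distrib mult_ac)
    then show ?thesis using c \<theta> by simp
  qed
  ultimately show thesis using that[of "c * \<theta> ^ i" \<theta>] \<theta> by blast
qed

text \<open>By induction on \<open>m\<close>: the sequence \<open>b\<close> of \<open>m\<close>-th differences is nonnegative and log-concave, and the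
two-step hypothesis, factored as \<open>(s - 1)^(m+1) (s + 1)^(m+1)\<close>, makes the weighted sums \<open>u\<close> of its
terms nondecreasing. A strict descent of \<open>b\<close> would make \<open>b\<close>, and hence \<open>u\<close>, decay geometrically.\<close>

lemma forward_differences_nonneg:
  assumes real: "jensen_real_rooted \<delta>" and nonneg: "\<And>n. \<delta> n \<ge> 0"
    and two_step: "\<And>m l. umbral \<delta> ([:-1, 0, 1:] ^ m * monom 1 l) \<ge> 0"
  shows "(forward_difference ^^ m) \<delta> l \<ge> 0"
proof (induction m arbitrary: l)
  case (Suc m)
  define b where "b = (forward_difference ^^ m) \<delta>"
  have b_real: "jensen_real_rooted b" unfolding b_def by (rule jensen_real_rooted_difference[OF real])
  have b_nonneg: "b l \<ge> 0" for l using Suc.IH by (simp add: b_def)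
  define w where "w i = coeff ([:1, 1 :: real:] ^ Suc m) i" for i
  define u where "u l = umbral b ([:1, 1:] ^ Suc m * monom 1 l)" for l
  have w: "w i \<ge> 0" "w 0 = 1" for i
    by (cases "i \<le> Suc m") (auto simp: w_def coeff_linear_poly_power coeff_eq_0 degree_linear_power
        simp del: power_Suc)
  have u: "u l = (\<Sum>i\<le>Suc m. w i * b (i + l))" for l
    unfolding u_def mult.commute[of _ "monom 1 l"] umbral_monom_mult
    by (subst umbral_cutoff[of _ "Suc m"]) (auto simp: degree_linear_power w_def simp del: power_Suc)
  have u_mono: "u l \<le> u (Suc l)" for l
  proof -
    have "[:-1, 0, 1 :: real:] = [:-1, 1:] * [:1, 1:]" by simp
    then have "[:-1, 0, 1 :: real:] ^ Suc m * monom 1 l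
        = [:-1, 1:] ^ m * ([:-1, 1:] * ([:1, 1:] ^ Suc m * monom 1 l))"
      by (simp only: power_mult_distrib) (simp only: power_Suc2 mult_ac)
    then have "0 \<le> umbral b ([:-1, 1:] * ([:1, 1:] ^ Suc m * monom 1 l))"
      using two_step[of "Suc m" l] by (simp only: umbral_forward_difference b_def)
    also have "[:-1, 1:] * ([:1, 1:] ^ Suc m * monom 1 l) =
        [:1, 1:] ^ Suc m * monom 1 (Suc l) - [:1, 1 :: real:] ^ Suc m * monom 1 l"
      by (simp add: monom_Suc del: power_Suc)
    finally show ?thesis by (simp add: umbral_diff u_def del: power_Suc)
  qed
  have "b k \<le> b (Suc k)" for k
  proof (rule ccontr)
    assume less: "\<not> b k \<le> b (Suc k)"
    then have "b k > 0" using b_nonneg[of "Suc k"] by linarith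
    define q where "q = b (Suc k) / b k"
    have q: "0 \<le> q" "q < 1" using less b_nonneg[of "Suc k"] \<open>b k > 0\<close> by (auto simp: q_def)
    \<comment> \<open>Log-concavity: once below 1, the ratio of consecutive terms stays below its first value.\<close>
    have ratio: "b (Suc (k + i)) \<le> q * b (k + i)" for i
    proof (induction i)
      case 0
      then show ?case using \<open>b k > 0\<close> by (simp add: q_def)
    next
      case (Suc i)
      show ?case
      proof (cases "b (Suc (k + i)) = 0")
        case True
        then have "b (Suc (Suc (k + i))) = 0"
          by (intro jensen_zero_persists[OF b_real _ _ _ True, of k] mult_nonneg_nonneg b_nonneg)
            (use \<open>b k > 0\<close> in auto)
        then show ?thesis using True by simp
      next
        case False
        then have pos: "b (Suc (k + i)) > 0" using b_nonneg[of "Suc (k + i)"] by linarith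
        then have pos': "b (k + i) > 0"
          using Suc.IH q b_nonneg[of "k + i"] by (cases "b (k + i) = 0") auto
        have "b (k + i) * b (Suc (Suc (k + i))) \<le> b (Suc (k + i)) * b (Suc (k + i))"
          using jensen_log_concave[OF b_real, of "k + i"] by (simp add: power2_eq_square)
        also have "\<dots> \<le> q * b (k + i) * b (Suc (k + i))"
          using Suc.IH pos by (intro mult_right_mono) auto
        finally have "b (k + i) * b (Suc (Suc (k + i))) \<le> b (k + i) * (q * b (Suc (k + i)))"
          by (simp add: mult_ac)
        then show ?thesis using pos' by simp
      qed
    qed
    have decay: "b (k + i) \<le> q ^ i * b k" for i
    proof (induction i)
      case (Suc i)
      have "b (Suc (k + i)) \<le> q * (q ^ i * b k)"
        using ratio[of i] Suc q by (meson mult_left_mono order_trans)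
      then show ?case by (simp add: mult_ac)
    qed simp
    have "(\<lambda>i. u (k + i)) \<longlonglongrightarrow> 0"
    proof (rule tendsto_sandwich[of "\<lambda>_. 0" _ _ "\<lambda>i. q ^ i * (b k * (\<Sum>j\<le>Suc m. w j))"])
      show "\<forall>\<^sub>F i in sequentially. 0 \<le> u (k + i)"
        unfolding u using w(1) b_nonneg by (intro always_eventually allI sum_nonneg mult_nonneg_nonneg)
      show "\<forall>\<^sub>F i in sequentially. u (k + i) \<le> q ^ i * (b k * (\<Sum>j\<le>Suc m. w j))"
      proof (intro always_eventually allI)
        fix i
        have "b (j + (k + i)) \<le> q ^ i * b k" for j
        proof -
          have "b (k + (j + i)) \<le> q ^ (j + i) * b k" by (rule decay)
          also have "\<dots> \<le> q ^ i * b k"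
            using q \<open>b k > 0\<close> by (intro mult_right_mono power_decreasing) auto
          finally show ?thesis by (simp add: add_ac)
        qed
        then have "u (k + i) \<le> (\<Sum>j\<le>Suc m. w j * (q ^ i * b k))"
          unfolding u using w(1) by (intro sum_mono mult_left_mono)
        then show "u (k + i) \<le> q ^ i * (b k * (\<Sum>j\<le>Suc m. w j))"
          by (simp only: sum_distrib_left mult_ac)
      qed
      have "(\<lambda>i. q ^ i * (b k * (\<Sum>j\<le>Suc m. w j))) \<longlonglongrightarrow> 0 * (b k * (\<Sum>j\<le>Suc m. w j))"
        using q by (intro tendsto_mult LIMSEQ_realpow_zero tendsto_const)
      then show "(\<lambda>i. q ^ i * (b k * (\<Sum>j\<le>Suc m. w j))) \<longlonglongrightarrow> 0" by simp
    qed simp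
    \<comment> \<open>Monotonicity keeps \<open>u\<close> above \<open>u k\<close>, and \<open>u k\<close> is at least \<open>b k\<close>, so \<open>u\<close> cannot tend to 0.\<close>
    moreover have "u k \<le> u (k + i)" for i
      by (induction i) (use u_mono order_trans in \<open>auto\<close>)
    ultimately have "u k \<le> 0"
      by (intro LIMSEQ_le_const[of "\<lambda>i. u (k + i)"]) auto
    moreover have "w 0 * b (0 + k) \<le> u k"
      unfolding u using w(1) b_nonneg by (intro member_le_sum) (auto intro: mult_nonneg_nonneg)
    ultimately show False using w(2) \<open>b k > 0\<close> by simp
  qed
  then have "0 \<le> forward_difference b l" by (simp add: forward_difference_def)
  then show ?case by (simp add: b_def)
qed (use nonneg in simp)

section \<open>Hermite-diagonal operators on monomials and their coefficients\<close>

lemma smult_sum_distrib: "smult c (sum f A) = (\<Sum>x\<in>A. smult c (f x))"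
  by (induction A rule: infinite_finite_induct) (auto simp: smult_add_right)

text \<open>For \<open>\<gamma>\<^sub>n = s^n\<close> the operator that is diagonal on the Hermite polynomials maps \<open>exp (2xt)\<close> to
\<open>exp (2xts + t^2(1 - s^2))\<close>. The image of \<open>x^n\<close> is read off from the coefficient of \<open>t^n\<close>, and general
\<open>\<gamma>\<close> follows by applying the umbral functional.\<close>

definition monom_image_coeff :: "(nat \<Rightarrow> real) \<Rightarrow> nat \<Rightarrow> nat \<Rightarrow> real" where
  "monom_image_coeff \<gamma> n i =
     fact n / (fact i * fact (n - 2 * i) * 4 ^ i) * umbral \<gamma> (monom 1 (n - 2 * i) * [:1, 0, -1:] ^ i)"

definition monom_image :: "(nat \<Rightarrow> real) \<Rightarrow> nat \<Rightarrow> real poly" where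
  "monom_image \<gamma> n = (\<Sum>i\<le>n div 2. monom (monom_image_coeff \<gamma> n i) (n - 2 * i))"

lemma hermite_as_monoms:
  "hermite n = (\<Sum>k\<le>n div 2. smult ((-1) ^ k * fact n * 2 ^ (n - 2 * k) / (fact k * fact (n - 2 * k)))
     (monom 1 (n - 2 * k)))"
  by (simp add: hermite_def smult_monom)

lemma sum_triangle:
  fixes f :: "nat \<Rightarrow> nat \<Rightarrow> 'a :: comm_monoid_add"
  shows "(\<Sum>k\<le>n. \<Sum>i\<le>n - k. f k i) = (\<Sum>r\<le>n. \<Sum>k\<le>r. f k (r - k))"
proof -
  have "(\<Sum>k\<le>n. \<Sum>i\<le>n - k. f k i) = (\<Sum>(k, i)\<in>(SIGMA k:{..n}. {..n - k}). f k i)"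
    by (simp add: sum.Sigma)
  also have "(SIGMA k:{..n}. {..n - k}) = {(k, i). k + i \<le> n}" by auto
  finally show ?thesis by (simp add: sum.triangle_reindex_eq)
qed

text \<open>Substituting the candidates for the images of the monomials into \<open>H\<^sub>n\<close> gives \<open>\<gamma>\<^sub>n H\<^sub>n\<close>: the coefficient
at each power of \<open>x\<close> collapses by the binomial theorem for \<open>(-1 + (1 - s^2))^r\<close>.\<close>

lemma monom_image_hermite:
  "(\<Sum>k\<le>n div 2. smult ((-1) ^ k * fact n * 2 ^ (n - 2 * k) / (fact k * fact (n - 2 * k)))
     (monom_image \<gamma> (n - 2 * k))) = smult (\<gamma> n) (hermite n)"
proof -
  define N where "N = n div 2"
  define h :: "nat \<Rightarrow> real" where "h k = (-1) ^ k * fact n * 2 ^ (n - 2 * k) / (fact k * fact (n - 2 * k))" for k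
  have "(\<Sum>k\<le>N. smult (h k) (monom_image \<gamma> (n - 2 * k)))
      = (\<Sum>k\<le>N. \<Sum>i\<le>N - k. monom (h k * monom_image_coeff \<gamma> (n - 2 * k) i) (n - 2 * (k + i)))"
  proof (intro sum.cong refl)
    fix k assume "k \<in> {..N}"
    have "(n - 2 * k) div 2 = N - k" by (auto simp: N_def)
    then show "smult (h k) (monom_image \<gamma> (n - 2 * k)) =
        (\<Sum>i\<le>N - k. monom (h k * monom_image_coeff \<gamma> (n - 2 * k) i) (n - 2 * (k + i)))"
      by (simp add: monom_image_def smult_sum_distrib smult_monom algebra_simps)
  qed
  also have "\<dots> = (\<Sum>r\<le>N. \<Sum>k\<le>r. monom (h k * monom_image_coeff \<gamma> (n - 2 * k) (r - k)) (n - 2 * r))"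
    by (subst sum_triangle) (intro sum.cong refl, simp)
  also have "\<dots> = (\<Sum>r\<le>N. monom (\<gamma> n * h r) (n - 2 * r))"
  proof (intro sum.cong refl)
    fix r assume "r \<in> {..N}"
    then have r: "2 * r \<le> n" by (auto simp: N_def)
    have summand: "h k * monom_image_coeff \<gamma> (n - 2 * k) (r - k) =
        (-1) ^ r * h r * umbral \<gamma> (monom 1 (n - 2 * r) *
          (of_nat (r choose k) * [:-1:] ^ k * [:1, 0, -1:] ^ (r - k)))" if k: "k \<le> r" for k
    proof -
      have e: "n - 2 * k - 2 * (r - k) = n - 2 * r" using r k by auto
      have p: "[:-1:] ^ k = [:(-1) ^ k :: real:]" by (rule poly_const_pow)
      have "(2::real) ^ (n - 2 * k) = 2 ^ (n - 2 * r + 2 * (r - k))" using r k by (intro arg_cong[where f = "power 2"]) auto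
      then have pow: "(2::real) ^ (n - 2 * k) = 2 ^ (n - 2 * r) * 4 ^ (r - k)"
        by (simp only: power_add power_mult) simp
      have choose: "real (r choose k) = fact r / (fact k * fact (r - k))"
        using k by (simp add: binomial_fact)
      have "h k * monom_image_coeff \<gamma> (n - 2 * k) (r - k) =
         (-1) ^ k * fact n * 2 ^ (n - 2 * r) / (fact k * fact (r - k) * fact (n - 2 * r)) *
         umbral \<gamma> (monom 1 (n - 2 * r) * [:1, 0, -1:] ^ (r - k))"
        unfolding h_def monom_image_coeff_def e pow by (simp add: field_simps)
      also have "(-1) ^ k * fact n * 2 ^ (n - 2 * r) / (fact k * fact (r - k) * fact (n - 2 * r))
        = (-1) ^ r * h r * (real (r choose k) * (-1) ^ k)"
        unfolding h_def choose by (simp add: field_simps flip: power_mult_distrib)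
      also have "(-1) ^ r * h r * (real (r choose k) * (-1) ^ k) *
          umbral \<gamma> (monom 1 (n - 2 * r) * [:1, 0, -1:] ^ (r - k)) =
          (-1) ^ r * h r * umbral \<gamma> (smult (real (r choose k) * (-1) ^ k)
            (monom 1 (n - 2 * r) * [:1, 0, -1:] ^ (r - k)))"
        by (simp add: umbral_smult)
      also have "smult (real (r choose k) * (-1) ^ k) (monom 1 (n - 2 * r) * [:1, 0, -1:] ^ (r - k)) =
          monom 1 (n - 2 * r) * (of_nat (r choose k) * [:-1:] ^ k * [:1, 0, -1:] ^ (r - k))"
        unfolding p by (simp add: of_nat_poly mult_ac)
      finally show ?thesis .
    qed
    have "(\<Sum>k\<le>r. h k * monom_image_coeff \<gamma> (n - 2 * k) (r - k)) =
        (\<Sum>k\<le>r. (-1) ^ r * h r * umbral \<gamma> (monom 1 (n - 2 * r) *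
          (of_nat (r choose k) * [:-1:] ^ k * [:1, 0, -1:] ^ (r - k))))"
      using summand by (intro sum.cong) auto
    also have "\<dots> = (-1) ^ r * h r * umbral \<gamma> (monom 1 (n - 2 * r) *
        (\<Sum>k\<le>r. of_nat (r choose k) * [:-1:] ^ k * [:1, 0, -1:] ^ (r - k)))"
      by (simp only: umbral_sum sum_distrib_left)
    also have "(\<Sum>k\<le>r. of_nat (r choose k) * [:-1:] ^ k * [:1, 0, -1:] ^ (r - k))
        = ([:-1:] + [:1, 0, -1 :: real:]) ^ r"
      by (rule binomial_ring[symmetric])
    also have "[:-1:] + [:1, 0, -1 :: real:] = monom (-1) 2"
      by (simp add: numeral_2_eq_2 monom_Suc monom_0)
    also have "monom 1 (n - 2 * r) * monom (-1) 2 ^ r = monom ((-1 :: real) ^ r) n"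
      using r by (simp add: monom_power mult_monom)
    also have "(-1) ^ r * h r * umbral \<gamma> (monom ((-1) ^ r) n) = \<gamma> n * h r"
      by (simp add: umbral_monom flip: power_mult_distrib)
    finally show "(\<Sum>k\<le>r. monom (h k * monom_image_coeff \<gamma> (n - 2 * k) (r - k)) (n - 2 * r))
        = monom (\<gamma> n * h r) (n - 2 * r)"
      by (simp flip: monom_sum)
  qed
  also have "\<dots> = smult (\<gamma> n) (hermite n)"
    by (simp add: hermite_def h_def N_def smult_sum_distrib smult_monom)
  finally show ?thesis by (simp add: h_def N_def)
qed

text \<open>By induction, since \<open>H\<^sub>n\<close> is a nonzero multiple of \<open>x^n\<close> plus lower powers.\<close>

lemma hermite_diagonal_monom:
  fixes T :: "real poly \<Rightarrow> real poly"
  assumes linear: "Vector_Spaces.linear smult smult T"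
    and diag: "\<And>n. T (hermite n) = smult (\<gamma> n) (hermite n)"
  shows "T (monom 1 n) = monom_image \<gamma> n"
proof (induction n rule: less_induct)
  case (less n)
  interpret T: Vector_Spaces.linear smult smult T by (rule linear)
  define h :: "nat \<Rightarrow> real" where "h k = (-1) ^ k * fact n * 2 ^ (n - 2 * k) / (fact k * fact (n - 2 * k))" for k
  have "T (hermite n) = (\<Sum>k\<le>n div 2. smult (h k) (T (monom 1 (n - 2 * k))))"
    by (subst hermite_as_monoms) (simp add: T.sum T.scale h_def)
  then have "(\<Sum>k\<le>n div 2. smult (h k) (T (monom 1 (n - 2 * k)))) =
      (\<Sum>k\<le>n div 2. smult (h k) (monom_image \<gamma> (n - 2 * k)))"
    by (simp add: diag h_def monom_image_hermite)
  moreover have "(\<Sum>k\<in>{..n div 2} - {0}. smult (h k) (T (monom 1 (n - 2 * k)))) =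
      (\<Sum>k\<in>{..n div 2} - {0}. smult (h k) (monom_image \<gamma> (n - 2 * k)))"
    by (intro sum.cong refl) (use less in auto)
  ultimately have "smult (h 0) (T (monom 1 n)) = smult (h 0) (monom_image \<gamma> n)"
    by (simp add: sum.remove[of "{..n div 2}" 0])
  moreover have "h 0 \<noteq> 0" by (simp add: h_def)
  ultimately show ?case by (metis smult_cancel)
qed

lemma diff_operator_linear: "Vector_Spaces.linear smult smult (diff_operator Q)"
proof -
  have vs: "vector_space (smult :: real \<Rightarrow> real poly \<Rightarrow> real poly)"
    by unfold_locales (simp_all add: smult_add_right smult_add_left)
  show ?thesis
    unfolding Vector_Spaces.linear_iff
  proof (intro conjI allI vs)
    fix p q :: "real poly"
    let ?N = "max (degree p) (degree q)"
    have "degree (p + q) \<le> ?N" "degree p \<le> ?N" "degree q \<le> ?N" by (auto intro: degree_add_le)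
    then show "diff_operator Q (p + q) = diff_operator Q p + diff_operator Q q"
      by (simp add: diff_operator_cutoff[of _ ?N] higher_pderiv_add sum.distrib algebra_simps)
  next
    fix c :: real and p :: "real poly"
    show "diff_operator Q (smult c p) = smult c (diff_operator Q p)"
      by (simp add: diff_operator_cutoff[of _ "degree p"] higher_pderiv_smult smult_sum_distrib degree_smult_le)
  qed
qed

lemma higher_pderiv_monom_fact:
  "k \<le> n \<Longrightarrow> (pderiv ^^ k) (monom 1 n :: real poly) = monom (fact n / fact (n - k)) (n - k)"
proof (induction k)
  case (Suc k)
  then have "n - k = Suc (n - Suc k)" by simp
  moreover from this have "fact (n - k) = real (n - k) * fact (n - Suc k)" by (metis fact_Suc)
  ultimately show ?case using Suc by (simp add: pderiv_monom)
qed simp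

lemma diff_operator_monom:
  "diff_operator Q (monom 1 n) = (\<Sum>k\<le>n. Q k * monom (fact n / fact (n - k)) (n - k))"
  by (simp add: diff_operator_cutoff[of _ n] degree_monom_le higher_pderiv_monom_fact)

text \<open>Applied to \<open>x^n\<close>, the operator determines its \<open>n\<close>-th coefficient from the earlier ones.\<close>

lemma diff_operator_unique:
  assumes "\<And>n. diff_operator Q (monom 1 n) = diff_operator R (monom 1 n)"
  shows "Q n = R n"
proof (induction n rule: less_induct)
  case (less n)
  have "(\<Sum>k\<le>n. Q k * monom (fact n / fact (n - k)) (n - k)) =
      (\<Sum>k\<le>n. R k * monom (fact n / fact (n - k)) (n - k))"
    using assms[of n] by (simp only: diff_operator_monom)
  moreover have "(\<Sum>k<n. Q k * monom (fact n / fact (n - k)) (n - k)) =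
      (\<Sum>k<n. R k * monom (fact n / fact (n - k)) (n - k))"
    by (intro sum.cong refl) (use less in auto)
  ultimately have "Q n * monom (fact n / fact 0) 0 = R n * monom (fact n / fact 0) 0"
    by (simp add: lessThan_Suc_atMost[symmetric])
  then have "smult (fact n) (Q n - R n) = 0" by (simp add: monom_0 smult_diff_right)
  then show ?case by (simp del: smult_diff_right)
qed

text \<open>The coefficient of \<open>(2t)^k\<close> in \<open>exp (2xt(s - 1) - t^2(s^2 - 1))\<close>, with the umbral functional applied
in \<open>s\<close>.\<close>

definition hermite_diff_coeff :: "(nat \<Rightarrow> real) \<Rightarrow> nat \<Rightarrow> real poly" where
  "hermite_diff_coeff \<gamma> k = (\<Sum>j\<le>k div 2.
     monom ((-1) ^ j / (fact j * fact (k - 2 * j) * 4 ^ j) *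
       umbral \<gamma> ([:-1, 1:] ^ (k - j) * [:1, 1:] ^ j)) (k - 2 * j))"

text \<open>Collecting the powers of \<open>x\<close>, the coefficient at \<open>x^(n-2j)\<close> contains the binomial expansion of
\<open>((s - 1) + 1)^(n-2j)\<close>.\<close>

lemma diff_operator_hermite_diff_coeff:
  "diff_operator (hermite_diff_coeff \<gamma>) (monom 1 n) = monom_image \<gamma> n"
proof -
  define c :: "nat \<Rightarrow> nat \<Rightarrow> real" where "c k j = (-1) ^ j / (fact j * fact (k - 2 * j) * 4 ^ j) *
       umbral \<gamma> ([:-1, 1:] ^ (k - j) * [:1, 1:] ^ j)" for k j
  have "diff_operator (hermite_diff_coeff \<gamma>) (monom 1 n) =
      (\<Sum>k\<le>n. \<Sum>j\<le>k div 2. monom (fact n / fact (n - k) * c k j) (n - 2 * j))"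
    unfolding diff_operator_monom hermite_diff_coeff_def c_def[symmetric] sum_distrib_right
    by (intro sum.cong refl) (simp add: mult_monom mult.commute)
  also have "\<dots> = (\<Sum>(k, j)\<in>(SIGMA k:{..n}. {..k div 2}). monom (fact n / fact (n - k) * c k j) (n - 2 * j))"
    by (rule sum.Sigma) auto
  also have "\<dots> = (\<Sum>(j, l)\<in>(SIGMA j:{..n div 2}. {..n - 2 * j}).
      monom (fact n / fact (n - (2 * j + l)) * c (2 * j + l) j) (n - 2 * j))"
    by (rule sum.reindex_bij_witness[of _ "\<lambda>(j, l). (2 * j + l, j)" "\<lambda>(k, j). (j, k - 2 * j)"]) auto
  also have "\<dots> = (\<Sum>j\<le>n div 2. \<Sum>l\<le>n - 2 * j.
      monom (fact n / fact (n - (2 * j + l)) * c (2 * j + l) j) (n - 2 * j))"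
    by (rule sum.Sigma[symmetric]) auto
  also have "\<dots> = monom_image \<gamma> n"
    unfolding monom_image_def
  proof (intro sum.cong refl)
    fix j assume "j \<in> {..n div 2}"
    then have j: "2 * j \<le> n" by auto
    define b :: real where "b = fact n / (fact j * fact (n - 2 * j) * 4 ^ j)"
    have sq: "[:-1, 1:] * [:1, 1:] = [:-1, 0, 1 :: real:]" by simp
    have "fact n / fact (n - (2 * j + l)) * c (2 * j + l) j =
        b * (-1) ^ j * umbral \<gamma> ([:-1, 0, 1:] ^ j * (of_nat (n - 2 * j choose l) * [:-1, 1:] ^ l * 1 ^ (n - 2 * j - l)))"
      if l: "l \<le> n - 2 * j" for l
    proof -
      have "2 * j + l - j = j + l" by simp
      then have "[:-1, 1:] ^ (2 * j + l - j) * [:1, 1:] ^ j = [:-1, 0, 1 :: real:] ^ j * [:-1, 1:] ^ l"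
        by (simp only: power_add sq[symmetric] power_mult_distrib mult_ac)
      moreover have "[:-1, 0, 1:] ^ j * (of_nat (n - 2 * j choose l) * [:-1, 1:] ^ l * 1 ^ (n - 2 * j - l)) =
          smult (of_nat (n - 2 * j choose l)) ([:-1, 0, 1 :: real:] ^ j * [:-1, 1:] ^ l)"
        by (simp add: of_nat_poly mult_ac)
      moreover have "real (n - 2 * j choose l) = fact (n - 2 * j) / (fact l * fact (n - 2 * j - l))"
        using l by (simp add: binomial_fact)
      ultimately show ?thesis using l
        by (simp only: c_def b_def umbral_smult diff_diff_add[symmetric]) (simp add: field_simps)
    qed
    then have "(\<Sum>l\<le>n - 2 * j. fact n / fact (n - (2 * j + l)) * c (2 * j + l) j) =
        (\<Sum>l\<le>n - 2 * j. b * (-1) ^ j * umbral \<gamma>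
          ([:-1, 0, 1:] ^ j * (of_nat (n - 2 * j choose l) * [:-1, 1:] ^ l * 1 ^ (n - 2 * j - l))))"
      by (intro sum.cong) auto
    also have "\<dots> = b * (-1) ^ j * umbral \<gamma> ([:-1, 0, 1:] ^ j *
        (\<Sum>l\<le>n - 2 * j. of_nat (n - 2 * j choose l) * [:-1, 1:] ^ l * 1 ^ (n - 2 * j - l)))"
      by (simp only: umbral_sum sum_distrib_left)
    also have "(\<Sum>l\<le>n - 2 * j. of_nat (n - 2 * j choose l) * [:-1, 1:] ^ l * 1 ^ (n - 2 * j - l))
        = ([:-1, 1:] + 1 :: real poly) ^ (n - 2 * j)"
      by (rule binomial_ring[symmetric])
    also have "[:-1, 1:] + 1 = (monom 1 1 :: real poly)" by (simp add: one_pCons monom_Suc monom_0)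
    also have "b * (-1) ^ j * umbral \<gamma> ([:-1, 0, 1:] ^ j * monom 1 1 ^ (n - 2 * j)) =
        b * umbral \<gamma> (monom 1 (n - 2 * j) * (smult ((-1) ^ j) ([:-1, 0, 1:] ^ j)))"
      by (simp add: monom_power umbral_smult mult_ac)
    also have "smult ((-1) ^ j) ([:-1, 0, 1:] ^ j) = [:1, 0, -1 :: real:] ^ j"
      by (simp flip: smult_power)
    finally show "(\<Sum>l\<le>n - 2 * j. monom (fact n / fact (n - (2 * j + l)) * c (2 * j + l) j) (n - 2 * j))
        = monom (monom_image_coeff \<gamma> n j) (n - 2 * j)"
      by (simp add: monom_image_coeff_def b_def flip: monom_sum)
  qed
  finally show ?thesis .
qed

theorem diff_operator_coeffs:
  assumes "\<And>n. diff_operator Q (hermite n) = smult (\<gamma> n) (hermite n)"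
  shows "Q k = hermite_diff_coeff \<gamma> k"
  by (rule diff_operator_unique)
    (simp only: hermite_diagonal_monom[OF diff_operator_linear assms] diff_operator_hermite_diff_coeff)

section \<open>Constraints on a Hermite multiplier sequence\<close>

lemma coeff_monom_image:
  assumes "2 * i \<le> n"
  shows "coeff (monom_image \<gamma> n) (n - 2 * i) = monom_image_coeff \<gamma> n i"
proof -
  have "coeff (monom_image \<gamma> n) (n - 2 * i) =
      (\<Sum>j\<le>n div 2. if j = i then monom_image_coeff \<gamma> n j else 0)"
    unfolding monom_image_def coeff_sum coeff_monom
    by (intro sum.cong refl) (use assms in auto)
  also have "\<dots> = monom_image_coeff \<gamma> n i" using assms by auto
  finally show ?thesis .
qed

lemma coeff_monom_image_odd:
  assumes "odd (n + k)"
  shows "coeff (monom_image \<gamma> n) k = 0"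
  unfolding monom_image_def coeff_sum coeff_monom using assms
  by (intro sum.neutral) auto

lemma degree_monom_image: "degree (monom_image \<gamma> n) \<le> n"
  unfolding monom_image_def
  by (intro degree_sum_le) (auto intro: order_trans[OF degree_monom_le])

lemma monom_image_coeff_0: "monom_image_coeff \<gamma> n 0 = \<gamma> n"
  by (simp add: monom_image_coeff_def umbral_monom)

lemma monom_image_coeff_1:
  "monom_image_coeff \<gamma> (n + 2) 1 = real ((n + 2) * (n + 1)) / 4 * (\<gamma> n - \<gamma> (n + 2))"
proof -
  have "umbral \<gamma> (monom 1 n * [:1, 0, -1:]) = \<gamma> n - \<gamma> (n + 2)"
    by (subst umbral_monom_mult) (simp add: umbral_pCons)
  moreover have "fact (n + 2) = real ((n + 2) * (n + 1)) * fact n" by (simp add: algebra_simps)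
  ultimately show ?thesis by (simp add: monom_image_coeff_def del: mult_pCons_right of_nat_mult)
qed

lemma monom_image_coeff_2:
  "monom_image_coeff \<gamma> (n + 4) 2 = real ((n + 4) * (n + 3)) * real ((n + 2) * (n + 1)) / 32 *
     (\<gamma> n - 2 * \<gamma> (n + 2) + \<gamma> (n + 4))"
proof -
  have "[:1, 0, -1 :: real:] ^ 2 = [:1, 0, -2, 0, 1:]" by (simp add: power2_eq_square)
  moreover have "umbral \<gamma> (monom 1 n * [:1, 0, -2, 0, 1:]) = \<gamma> n - 2 * \<gamma> (n + 2) + \<gamma> (n + 4)"
    by (subst umbral_monom_mult) (simp add: umbral_pCons eval_nat_numeral)
  moreover have "fact (n + 4) = real ((n + 4) * (n + 3)) * real ((n + 2) * (n + 1)) * fact n"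
    by (simp add: eval_nat_numeral algebra_simps)
  ultimately show ?thesis by (simp add: monom_image_coeff_def del: mult_pCons_right of_nat_mult)
qed

locale hermite_multiplier =
  fixes T :: "real poly \<Rightarrow> real poly" and \<gamma> :: "nat \<Rightarrow> real"
  assumes linear: "Vector_Spaces.linear smult smult T"
    and diagonal: "T (hermite n) = smult (\<gamma> n) (hermite n)"
    and preserves: "only_real_zeros p \<Longrightarrow> only_real_zeros (T p)"
begin

lemma T_monom: "T (monom 1 n) = monom_image \<gamma> n"
  by (rule hermite_diagonal_monom[OF linear diagonal])

lemma T_as_monom_images:
  assumes "degree p \<le> N"
  shows "T p = (\<Sum>n\<le>N. smult (coeff p n) (monom_image \<gamma> n))"
proof -
  interpret T: Vector_Spaces.linear smult smult T by (rule linear)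
  have "p = (\<Sum>n\<le>N. smult (coeff p n) (monom 1 n))"
    using poly_as_sum_of_monoms'[OF assms] by (simp add: smult_monom)
  then have "T p = T (\<Sum>n\<le>N. smult (coeff p n) (monom 1 n))" by simp
  then show ?thesis by (simp add: T.sum T.scale T_monom)
qed

text \<open>Every Hermite multiplier sequence is a multiplier sequence for the monomial basis: conjugating the
operator with dilations and letting the scale tend to 0 removes all but the leading term of the image
of each monomial.\<close>

lemma classical_multiplier:
  assumes "only_real_zeros p" and deg: "degree p \<le> N"
  shows "only_real_zeros (\<Sum>n\<le>N. monom (coeff p n * \<gamma> n) n)"
proof (rule only_real_zeros_limit)
  \<comment> \<open>The scales, tending to 0; the term with index \<open>i\<close> in the image of a monomial picks up the factor \<open>(e k)^(2i)\<close>.\<close>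
  define e :: "nat \<Rightarrow> real" where "e k = inverse (real (Suc k))" for k
  have e: "e k \<noteq> 0" for k by (simp add: e_def)
  define F where "F k = pcompose (T (pcompose p [:0, e k:])) [:0, inverse (e k):]" for k
  show "only_real_zeros (F k)" for k
    unfolding F_def using e assms(1) by (intro only_real_zeros_dilate preserves) auto
  fix z :: complex
  have F: "poly (complex_poly (F k)) z = (\<Sum>n\<le>N. \<Sum>i\<le>n div 2.
      of_real (coeff p n * monom_image_coeff \<gamma> n i) * z ^ (n - 2 * i) * of_real (e k ^ (2 * i)))" for k
  proof -
    have coeff: "coeff (pcompose p [:0, e k:]) n = e k ^ n * coeff p n" for n
      by (simp add: coeff_pcompose_linear)
    have "degree (pcompose p [:0, e k:]) \<le> N" using deg e by (simp add: degree_pcompose)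
    then have "F k = (\<Sum>n\<le>N. smult (e k ^ n * coeff p n) (pcompose (monom_image \<gamma> n) [:0, inverse (e k):]))"
      unfolding F_def by (simp add: T_as_monom_images coeff pcompose_sum pcompose_smult)
    then have "poly (complex_poly (F k)) z = (\<Sum>n\<le>N. of_real (e k ^ n * coeff p n) *
        poly (complex_poly (monom_image \<gamma> n)) (of_real (inverse (e k)) * z))"
      by (simp add: poly_sum complex_poly_pcompose poly_pcompose mult_ac)
    also have "\<dots> = (\<Sum>n\<le>N. \<Sum>i\<le>n div 2.
      of_real (coeff p n * monom_image_coeff \<gamma> n i) * z ^ (n - 2 * i) * of_real (e k ^ (2 * i)))"
    proof (intro sum.cong refl)
      fix n
      show "of_real (e k ^ n * coeff p n) * poly (complex_poly (monom_image \<gamma> n)) (of_real (inverse (e k)) * z)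
        = (\<Sum>i\<le>n div 2. of_real (coeff p n * monom_image_coeff \<gamma> n i) * z ^ (n - 2 * i) * of_real (e k ^ (2 * i)))"
        unfolding monom_image_def complex_poly_sum poly_sum sum_distrib_left
      proof (intro sum.cong refl)
        fix i assume "i \<in> {..n div 2}"
        then have "n = (n - 2 * i) + 2 * i" by auto
        then have "e k ^ n = e k ^ (n - 2 * i) * e k ^ (2 * i)" by (metis power_add)
        then have "e k ^ n * inverse (e k) ^ (n - 2 * i) = e k ^ (2 * i)"
          using e[of k] by (simp add: field_simps)
        then have "(of_real (e k ^ n) * of_real (inverse (e k)) ^ (n - 2 * i) :: complex) = of_real (e k ^ (2 * i))"
          by (metis of_real_mult of_real_power)
        then show "of_real (e k ^ n * coeff p n) * poly (complex_poly (monom (monom_image_coeff \<gamma> n i) (n - 2 * i)))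
             (of_real (inverse (e k)) * z) =
           of_real (coeff p n * monom_image_coeff \<gamma> n i) * z ^ (n - 2 * i) * of_real (e k ^ (2 * i))"
          by (simp add: poly_monom power_mult_distrib mult_ac)
      qed
    qed
    finally show ?thesis .
  qed
  have "(\<lambda>k. e k ^ (2 * i)) \<longlonglongrightarrow> (if i = 0 then 1 else 0)" for i
  proof (cases "i = 0")
    case False
    have "e \<longlonglongrightarrow> 0" unfolding e_def by (rule LIMSEQ_inverse_real_of_nat)
    then have "(\<lambda>k. e k ^ (2 * i)) \<longlonglongrightarrow> 0 ^ (2 * i)" by (rule tendsto_power)
    moreover have "(0 :: real) ^ (2 * i) = 0" using False by simp
    ultimately show ?thesis using False by (simp only: if_False)
  qed simp
  then have "(\<lambda>k. poly (complex_poly (F k)) z) \<longlonglongrightarrow> (\<Sum>n\<le>N. \<Sum>i\<le>n div 2.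
      of_real (coeff p n * monom_image_coeff \<gamma> n i) * z ^ (n - 2 * i) * of_real (if i = 0 then 1 else 0))"
    unfolding F by (intro tendsto_sum tendsto_mult tendsto_const tendsto_of_real)
  also have "(\<Sum>n\<le>N. \<Sum>i\<le>n div 2. of_real (coeff p n * monom_image_coeff \<gamma> n i) * z ^ (n - 2 * i) *
      of_real (if i = 0 then 1 else 0)) = poly (complex_poly (\<Sum>n\<le>N. monom (coeff p n * \<gamma> n) n)) z"
    by (simp add: poly_sum poly_monom sum.atMost_shift monom_image_coeff_0)
  finally show "(\<lambda>k. poly (complex_poly (F k)) z) \<longlonglongrightarrow> poly (complex_poly (\<Sum>n\<le>N. monom (coeff p n * \<gamma> n) n)) z" .
qed

lemma jensen_real: "jensen_real_rooted \<gamma>"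
  unfolding jensen_real_rooted_def
proof
  fix n
  have "only_real_zeros ([:1, 1:] ^ n)" by (intro only_real_zeros_power only_real_zeros_linear) simp
  then have "only_real_zeros (\<Sum>k\<le>n. monom (coeff ([:1, 1:] ^ n) k * \<gamma> k) k)"
    by (rule classical_multiplier) (simp add: degree_linear_power)
  also have "(\<Sum>k\<le>n. monom (coeff ([:1, 1:] ^ n) k * \<gamma> k) k) = jensen_poly \<gamma> n"
    unfolding jensen_poly_def by (intro sum.cong refl) (simp add: coeff_linear_poly_power)
  finally show "only_real_zeros (jensen_poly \<gamma> n)" .
qed

text \<open>Apply \<open>classical_multiplier\<close> to \<open>x^k (x^2 - 1)\<close>.\<close>

lemma same_sign_two_apart: "\<gamma> k * \<gamma> (k + 2) \<ge> 0"
proof -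
  let ?p = "monom 1 k * ([:1, 1:] * [:-1, 1 :: real:])"
  have p: "?p = monom 1 (k + 2) - monom 1 k"
    by (simp add: mult_monom numeral_2_eq_2 monom_Suc algebra_simps)
  have "only_real_zeros ?p"
    by (intro only_real_zeros_mult only_real_zeros_monom only_real_zeros_linear) auto
  then have "only_real_zeros (\<Sum>n\<le>k + 2. monom (coeff ?p n * \<gamma> n) n)"
    by (rule classical_multiplier) (simp only: p, intro degree_diff_le degree_monom_le[THEN order_trans], auto)
  also have "(\<Sum>n\<le>k + 2. monom (coeff ?p n * \<gamma> n) n) = monom 1 k * [:- \<gamma> k, 2 * 0, \<gamma> (k + 2):]"
    unfolding p
    by (rule poly_eqI) (auto simp: coeff_sum coeff_monom_mult coeff_pCons if_distrib numeral_2_eq_2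
        split: nat.splits cong: if_cong)
  finally have "only_real_zeros [:- \<gamma> k, 2 * 0, \<gamma> (k + 2):]"
    by (rule only_real_zeros_factor) simp
  from quadratic_discriminant_nonneg[OF this] show ?thesis by simp
qed

text \<open>The image of \<open>x^(l+2m)\<close> is a real-rooted even or odd polynomial with leading coefficient \<open>\<gamma> (l + 2m)\<close>,
and its coefficient at \<open>x^l\<close> is a positive multiple of \<open>(-1)^m L ((s^2 - 1)^m s^l)\<close>. Differentiating
\<open>l\<close> times turns it into an even polynomial of which these are the outer coefficients.\<close>

lemma two_step_difference_sign: "\<gamma> (l + 2 * m) * umbral \<gamma> ([:-1, 0, 1:] ^ m * monom 1 l) \<ge> 0"
proof -
  let ?n = "l + 2 * m"
  let ?q = "(pderiv ^^ l) (monom_image \<gamma> ?n)"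
  have coeff: "\<exists>c>0. coeff ?q k = c * coeff (monom_image \<gamma> ?n) (k + l)" for k
    unfolding coeff_higher_pderiv by (rule exI[of _ "pochhammer (of_nat (Suc k)) l"]) (auto intro: pochhammer_pos)
  have "only_real_zeros (monom_image \<gamma> ?n)"
    using preserves[OF only_real_zeros_monom[of ?n]] by (simp only: T_monom)
  then have "only_real_zeros ?q" by (rule only_real_zeros_higher_pderiv)
  moreover have "coeff ?q k = 0" if "odd k" for k
    using coeff[of k] coeff_monom_image_odd[of ?n "k + l" \<gamma>] that by auto
  moreover have "degree ?q \<le> 2 * m"
    using degree_monom_image[of \<gamma> ?n] by (simp add: degree_higher_pderiv)
  ultimately have sign: "(-1) ^ m * coeff ?q (2 * m) * coeff ?q 0 \<ge> 0" by (rule even_real_rooted_coeff_sign)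
  obtain c where c: "c > 0" "coeff ?q (2 * m) = c * \<gamma> ?n"
    using coeff[of "2 * m"] coeff_monom_image[of 0 ?n \<gamma>]
    by (auto simp: monom_image_coeff_0 add.commute)
  have "[:1, 0, -1:] = smult (-1) [:-1, 0, 1 :: real:]" by simp
  then have flip: "[:1, 0, -1:] ^ m = smult ((-1) ^ m) ([:-1, 0, 1 :: real:] ^ m)"
    by (simp only: smult_power)
  obtain d where d: "d > 0" "coeff ?q 0 = d * (-1) ^ m * umbral \<gamma> ([:-1, 0, 1:] ^ m * monom 1 l)"
  proof -
    obtain c where "c > 0" "coeff ?q 0 = c * monom_image_coeff \<gamma> ?n m"
      using coeff[of 0] coeff_monom_image[of m ?n \<gamma>] by auto
    then show thesis
      by (intro that[of "c * (fact ?n / (fact m * fact l * 4 ^ m))"])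
        (auto simp: monom_image_coeff_def flip umbral_smult mult_ac)
  qed
  have "(-1) ^ m * coeff ?q (2 * m) * coeff ?q 0 =
      (c * d) * (\<gamma> ?n * umbral \<gamma> ([:-1, 0, 1:] ^ m * monom 1 l))"
    unfolding c(2) d(2) by (simp add: algebra_simps flip: power_add mult_2)
  moreover have "0 < c * d" using c(1) d(1) by simp
  ultimately show ?thesis using sign by (metis mult_le_cancel_left_pos mult_zero_right)
qed

text \<open>Suppose the term after next vanishes. The coefficient at \<open>x^(N+2)\<close> of the image of
\<open>x^(N+2) - a x^(N+4)\<close> is then a multiple of \<open>\<gamma> (N + 2)\<close> which becomes small for \<open>a\<close> slightly below
\<open>4 / ((N + 3)(N + 4))\<close>, whereas the coefficient at \<open>x^N\<close> stays near a positive multiple of \<open>\<gamma> N\<close>. So both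
have the same sign and \<open>N\<close> differentiations leave an even quadratic without real zeros.\<close>

lemma no_last_term:
  assumes "\<gamma> N * \<gamma> (N + 2) > 0"
  shows "\<gamma> (N + 4) \<noteq> 0"
proof
  assume zero: "\<gamma> (N + 4) = 0"
  define P where "P = \<gamma> N * \<gamma> (N + 2)"
  define S where "S = (\<gamma> (N + 2))\<^sup>2"
  define K where "K = real ((N + 4) * (N + 3)) / 4"
  define B where "B = real ((N + 2) * (N + 1)) / 4"
  \<comment> \<open>Small enough for \<open>\<epsilon> * S < P / 2\<close>, and in \<open>(0, 1)\<close>; the coefficient at \<open>x^(N+2)\<close> becomes \<open>\<epsilon> * \<gamma> (N + 2)\<close>.\<close>
  define \<epsilon> where "\<epsilon> = P / (2 * S + P)"
  define a where "a = (1 - \<epsilon>) / K"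
  have PS: "P > 0" "S > 0" using assms by (auto simp: P_def S_def)
  have \<epsilon>: "0 < \<epsilon>" "\<epsilon> < 1" using PS by (auto simp: \<epsilon>_def)
  have pos: "K > 0" "B > 0"
    unfolding K_def B_def by (simp_all only: zero_less_divide_iff of_nat_0_less_iff) simp_all
  have "a > 0" using \<epsilon> pos by (simp add: a_def)
  let ?p = "monom 1 (N + 2) * ([:1, sqrt a:] * [:1, - sqrt a:])"
  have p: "?p = monom 1 (N + 2) - smult a (monom 1 (N + 4))"
  proof -
    have "[:1, sqrt a:] * [:1, - sqrt a:] = 1 - smult a (monom 1 2)"
      using \<open>a > 0\<close> by (simp add: numeral_2_eq_2 monom_Suc monom_0 one_pCons)
    then show ?thesis
      by (simp only: right_diff_distrib mult_smult_right mult_monom mult_1_right) (simp add: eval_nat_numeral)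
  qed
  interpret T: Vector_Spaces.linear smult smult T by (rule linear)
  have "only_real_zeros ?p"
    using \<open>a > 0\<close> by (intro only_real_zeros_mult only_real_zeros_monom only_real_zeros_linear) auto
  from preserves[OF this] have "only_real_zeros (T ?p)" .
  define F where "F = monom_image \<gamma> (N + 2) - smult a (monom_image \<gamma> (N + 4))"
  have "T ?p = F"
    by (simp only: p T.diff T.scale T_monom F_def)
  then have real: "only_real_zeros F" using \<open>only_real_zeros (T ?p)\<close> by (simp only:)
  let ?q = "(pderiv ^^ N) F"
  have coeff: "\<exists>c>0. coeff ?q k = c * coeff F (k + N)" for k
    unfolding coeff_higher_pderiv by (rule exI[of _ "pochhammer (of_nat (Suc k)) N"]) (auto intro: pochhammer_pos)
  have T4: "coeff F (N + 4) = 0"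
    using coeff_monom_image[of 0 "N + 4" \<gamma>] degree_monom_image[of \<gamma> "N + 2"]
    by (simp add: F_def coeff_eq_0 monom_image_coeff_0 zero)
  have T2: "coeff F (N + 2) = \<epsilon> * \<gamma> (N + 2)"
  proof -
    have "monom_image_coeff \<gamma> (N + 4) 1 = K * \<gamma> (N + 2)"
      using monom_image_coeff_1[of \<gamma> "N + 2"] zero by (simp add: K_def eval_nat_numeral)
    then have "coeff F (N + 2) = \<gamma> (N + 2) - a * (K * \<gamma> (N + 2))"
      using coeff_monom_image[of 0 "N + 2" \<gamma>] coeff_monom_image[of 1 "N + 4" \<gamma>]
      by (simp add: F_def monom_image_coeff_0)
    also have "\<dots> = \<epsilon> * \<gamma> (N + 2)" using pos by (simp add: a_def field_simps)
    finally show ?thesis .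
  qed
  have T0: "coeff F N = B * ((1 + \<epsilon>) / 2 * \<gamma> N - \<epsilon> * \<gamma> (N + 2))"
  proof -
    have "monom_image_coeff \<gamma> (N + 4) 2 = K * B / 2 * (\<gamma> N - 2 * \<gamma> (N + 2))"
      using zero by (simp add: monom_image_coeff_2 K_def B_def)
    moreover have "monom_image_coeff \<gamma> (N + 2) 1 = B * (\<gamma> N - \<gamma> (N + 2))"
      by (simp only: monom_image_coeff_1 B_def)
    ultimately have "coeff F N = B * (\<gamma> N - \<gamma> (N + 2)) - a * (K * B / 2 * (\<gamma> N - 2 * \<gamma> (N + 2)))"
      using coeff_monom_image[of 1 "N + 2" \<gamma>] coeff_monom_image[of 2 "N + 4" \<gamma>]
      by (simp add: F_def)
    also have "\<dots> = B * ((1 + \<epsilon>) / 2 * \<gamma> N - \<epsilon> * \<gamma> (N + 2))"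
      using pos by (simp add: a_def field_simps)
    finally show ?thesis .
  qed
  have "only_real_zeros ?q" using real by (rule only_real_zeros_higher_pderiv)
  moreover have "coeff ?q k = 0" if "odd k" for k
    using coeff[of k] coeff_monom_image_odd[of "N + 2" "k + N" \<gamma>]
      coeff_monom_image_odd[of "N + 4" "k + N" \<gamma>] that by (auto simp: F_def)
  moreover have "degree ?q \<le> 2 * 1"
  proof (rule degree_le, intro allI impI)
    fix k :: nat assume "2 * 1 < k"
    then consider "k = 3" | "k = 4" | "k > 4" by linarith
    then show "coeff ?q k = 0"
    proof cases
      case 1
      then show ?thesis using coeff[of k] coeff_monom_image_odd[of "N + 2" "k + N" \<gamma>]
        coeff_monom_image_odd[of "N + 4" "k + N" \<gamma>] by (auto simp: F_def)
    next
      case 2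
      then show ?thesis using coeff[of k] T4 by (auto simp: add.commute)
    next
      case 3
      then show ?thesis using coeff[of k] degree_monom_image[of \<gamma> "N + 2"]
        degree_monom_image[of \<gamma> "N + 4"] by (auto simp: F_def coeff_eq_0)
    qed
  qed
  ultimately have sign: "(-1) ^ 1 * coeff ?q (2 * 1) * coeff ?q 0 \<ge> 0" by (rule even_real_rooted_coeff_sign)
  obtain c where c: "c > 0" "coeff ?q 2 = c * (\<epsilon> * \<gamma> (N + 2))"
    using coeff[of 2] T2 by (auto simp: add.commute)
  obtain d where d: "d > 0" "coeff ?q 0 = d * (B * ((1 + \<epsilon>) / 2 * \<gamma> N - \<epsilon> * \<gamma> (N + 2)))"
    using coeff[of 0] T0 by auto
  have "\<epsilon> * S < P / 2" using PS by (simp add: \<epsilon>_def field_simps)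
  moreover have "P / 2 \<le> (1 + \<epsilon>) / 2 * P" using \<epsilon> PS by (simp add: field_simps)
  ultimately have "(1 + \<epsilon>) / 2 * P - \<epsilon> * S > 0" by linarith
  moreover have "coeff ?q 2 * coeff ?q 0 = (c * d * \<epsilon> * B) * ((1 + \<epsilon>) / 2 * P - \<epsilon> * S)"
    unfolding c(2) d(2) P_def S_def by (simp add: algebra_simps power2_eq_square)
  ultimately have "coeff ?q 2 * coeff ?q 0 > 0" using c(1) d(1) \<epsilon> pos by simp
  then show False using sign by simp
qed

text \<open>If the support ends after at most two terms, the sequence is trivial. If it ends later, its last
nonzero term and the one two places before contradict \<open>no_last_term\<close>.\<close>

lemma support_upward_closed:
  assumes nontrivial: "\<not> trivial_sequence \<gamma>" and "\<gamma> i \<noteq> 0" "i \<le> n"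
  shows "\<gamma> n \<noteq> 0"
proof
  assume "\<gamma> n = 0"
  note persists = jensen_zero_persists[OF jensen_real same_sign_two_apart]
  define i0 where "i0 = (LEAST n. \<gamma> n \<noteq> 0)"
  have i0: "\<gamma> i0 \<noteq> 0" using assms(2) unfolding i0_def by (rule LeastI)
  have below: "\<gamma> n = 0" if "n < i0" for n using that not_less_Least unfolding i0_def by blast
  have "i0 \<le> i" using assms(2) unfolding i0_def by (rule Least_le)
  define z where "z = (LEAST n. n > i0 \<and> \<gamma> n = 0)"
  have "n > i0 \<and> \<gamma> n = 0"
    using \<open>i0 \<le> i\<close> \<open>i \<le> n\<close> \<open>\<gamma> n = 0\<close> i0 by (metis le_neq_implies_less order_trans)
  then have z: "z > i0" "\<gamma> z = 0" unfolding z_def by (metis (mono_tags, lifting) LeastI)+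
  have before: "\<gamma> n \<noteq> 0" if "i0 < n" "n < z" for n
    using that not_less_Least unfolding z_def by blast
  have after: "\<gamma> n = 0" if "n \<ge> z" for n using persists[OF i0 z that] .
  show False
  proof (cases "z \<le> i0 + 2")
    case True
    have "\<gamma> = (\<lambda>n. if n = i0 then \<gamma> i0 else if n = Suc i0 then \<gamma> (Suc i0) else 0)"
    proof
      fix n
      consider "n < i0" | "n = i0" | "n = Suc i0" | "n \<ge> z" "n > Suc i0" using True z by linarith
      then show "\<gamma> n = (if n = i0 then \<gamma> i0 else if n = Suc i0 then \<gamma> (Suc i0) else 0)"
        by cases (auto simp: below after)
    qed
    then show False using nontrivial unfolding trivial_sequence_def by blast
  next
    case False
    define N where "N = z - 3"
    have N: "z = N + 3" "N \<ge> i0" using False by (auto simp: N_def)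
    have "\<gamma> N \<noteq> 0" using before[of N] N i0 by (cases "N = i0") auto
    moreover have "\<gamma> (N + 2) \<noteq> 0" using before[of "N + 2"] N by auto
    ultimately have "\<gamma> N * \<gamma> (N + 2) > 0"
      using same_sign_two_apart[of N] by (metis mult_eq_0_iff order_le_less)
    then show False using no_last_term[of N] after[of "N + 4"] N by simp
  qed
qed

text \<open>Write \<open>\<gamma>\<^sub>n = c \<theta>^n \<delta>\<^sub>n\<close> with \<open>\<delta> \<ge> 0\<close> and signs \<open>c\<close> and \<open>\<theta>\<close>. All forward differences of \<open>\<delta>\<close> are
nonnegative, and \<open>(s + 1)^q\<close> has nonnegative coefficients, so the umbral functional of \<open>\<delta>\<close> is
nonnegative on \<open>(s - 1)^p (s + 1)^q\<close>. For \<open>\<theta> = -1\<close> the substitution of \<open>- s\<close> for \<open>s\<close> exchanges the two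
factors up to the sign \<open>(-1)^(p+q)\<close>.\<close>

lemma differences_sign:
  assumes nontrivial: "\<not> trivial_sequence \<gamma>"
  obtains \<tau> :: real where "\<tau> \<noteq> 0"
    "\<And>p q. p + q = k \<Longrightarrow> \<tau> * umbral \<gamma> ([:-1, 1:] ^ p * [:1, 1:] ^ q) \<ge> 0"
proof -
  obtain c \<theta> :: real where c: "c * c = 1" and \<theta>: "\<theta> * \<theta> = 1" and sign: "\<And>n. \<gamma> n = c * \<theta> ^ n * \<bar>\<gamma> n\<bar>"
    by (rule jensen_sign_pattern[OF jensen_real same_sign_two_apart], rule that)
  define \<delta> where "\<delta> n = \<bar>\<gamma> n\<bar>" for n
  have \<gamma>: "\<gamma> = (\<lambda>n. c * \<theta> ^ n * \<delta> n)" unfolding \<delta>_def by (intro ext sign)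
  have signed: "umbral \<gamma> p = c * umbral \<delta> (pcompose p [:0, \<theta>:])" for p
    using umbral_signed[of c \<theta> \<delta> p] by (simp only: \<gamma>[symmetric])
  have "\<theta> = 1 \<or> \<theta> = -1" using \<theta> by (metis square_eq_1_iff)
  have "\<theta> \<noteq> 0" "c \<noteq> 0" using \<theta> c by auto
  have \<theta>_pow: "\<theta> ^ n * \<theta> ^ n = 1" for n using \<theta> by (simp flip: power_mult_distrib)
  have \<delta>: "\<delta> n = c * \<theta> ^ n * \<gamma> n" for n
  proof -
    have "c * \<theta> ^ n * \<gamma> n = (c * c) * (\<theta> ^ n * \<theta> ^ n) * \<delta> n" by (subst \<gamma>) (simp add: mult_ac)
    then show ?thesis by (simp add: c \<theta>_pow)
  qed
  have "jensen_real_rooted \<delta>"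
    unfolding jensen_real_rooted_def
  proof
    fix n
    have "jensen_poly \<delta> n = smult c (pcompose (jensen_poly \<gamma> n) [:0, \<theta>:])"
      by (rule poly_eqI) (simp add: coeff_jensen_poly coeff_pcompose_linear \<delta> mult_ac)
    moreover have "only_real_zeros (pcompose (jensen_poly \<gamma> n) [:0, \<theta>:])"
      using jensen_real \<open>\<theta> \<noteq> 0\<close> by (intro only_real_zeros_dilate) (auto simp: jensen_real_rooted_def)
    ultimately show "only_real_zeros (jensen_poly \<delta> n)"
      using \<open>c \<noteq> 0\<close> by (simp add: only_real_zeros_smult_iff)
  qed
  moreover have "umbral \<delta> ([:-1, 0, 1:] ^ m * monom 1 l) \<ge> 0" for m l
  proof (cases "\<gamma> (l + 2 * m) = 0")
    case True
    have "degree ([:-1, 0, 1 :: real:] ^ m * monom 1 l) \<le> l + 2 * m"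
      by (rule order_trans[OF degree_mult_le]) (simp add: degree_power_eq degree_monom_eq)
    then have "umbral \<delta> ([:-1, 0, 1:] ^ m * monom 1 l) = umbral (\<lambda>_. 0) ([:-1, 0, 1:] ^ m * monom 1 l)"
      using support_upward_closed[OF nontrivial] True by (intro umbral_cong) (auto simp: \<delta>_def)
    then show ?thesis by (simp add: umbral_def)
  next
    case False
    have "pcompose ([:-1, 0, 1:] ^ m * monom 1 l) [:0, \<theta>:] = smult (\<theta> ^ l) ([:-1, 0, 1:] ^ m * monom 1 l)"
    proof (rule poly_eq_poly_eq_iff[THEN iffD1], rule ext)
      fix x
      show "poly (pcompose ([:-1, 0, 1:] ^ m * monom 1 l) [:0, \<theta>:]) x =
          poly (smult (\<theta> ^ l) ([:-1, 0, 1:] ^ m * monom 1 l)) x"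
        using \<open>\<theta> = 1 \<or> \<theta> = -1\<close>
        by (elim disjE) (simp_all add: poly_pcompose poly_power poly_monom mult_ac power_minus[of x])
    qed
    then have "umbral \<gamma> ([:-1, 0, 1:] ^ m * monom 1 l) = c * \<theta> ^ l * umbral \<delta> ([:-1, 0, 1:] ^ m * monom 1 l)"
      unfolding signed by (simp only: umbral_smult mult.assoc)
    moreover have "\<gamma> (l + 2 * m) = c * \<theta> ^ l * \<delta> (l + 2 * m)"
      using \<theta> by (subst \<gamma>) (simp add: power_add power_mult power2_eq_square)
    ultimately have "\<gamma> (l + 2 * m) * umbral \<gamma> ([:-1, 0, 1:] ^ m * monom 1 l) =
        (c * c) * (\<theta> ^ l * \<theta> ^ l) * (\<delta> (l + 2 * m) * umbral \<delta> ([:-1, 0, 1:] ^ m * monom 1 l))"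
      by (simp only: mult_ac)
    then have "\<delta> (l + 2 * m) * umbral \<delta> ([:-1, 0, 1:] ^ m * monom 1 l) \<ge> 0"
      using two_step_difference_sign[of l m] by (simp only: c \<theta>_pow mult_1)
    moreover have "\<delta> (l + 2 * m) > 0" using False by (simp add: \<delta>_def)
    ultimately show ?thesis by (simp only: zero_le_mult_iff) linarith
  qed
  ultimately have diff: "(forward_difference ^^ p) \<delta> l \<ge> 0" for p l
    by (intro forward_differences_nonneg) (auto simp: \<delta>_def)
  have pos: "umbral \<delta> ([:-1, 1:] ^ p * [:1, 1:] ^ q) \<ge> 0" for p q
    unfolding umbral_forward_difference unfolding umbral_def
    by (intro sum_nonneg mult_nonneg_nonneg diff)
      (auto simp: coeff_linear_poly_power degree_linear_power)
  show thesis
  proof (cases "\<theta> = 1")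
    case True
    have "c * umbral \<gamma> ([:-1, 1:] ^ p * [:1, 1:] ^ q) \<ge> 0" for p q
    proof -
      have "c * umbral \<gamma> ([:-1, 1:] ^ p * [:1, 1:] ^ q) = (c * c) * umbral \<delta> ([:-1, 1:] ^ p * [:1, 1:] ^ q)"
        unfolding signed True pcompose_idR by (simp only: mult.assoc)
      then show ?thesis using pos[of p q] by (simp only: c mult_1)
    qed
    then show thesis using that[of c] \<open>c \<noteq> 0\<close> by blast
  next
    case False
    then have \<theta>: "\<theta> = -1" using \<open>\<theta> = 1 \<or> \<theta> = -1\<close> by simp
    have "c * (-1) ^ k * umbral \<gamma> ([:-1, 1:] ^ p * [:1, 1:] ^ q) \<ge> 0" if "p + q = k" for p q
    proof -
      have 1: "[:-1, -1 :: real:] = smult (-1) [:1, 1:]" and 2: "[:1, -1 :: real:] = smult (-1) [:-1, 1:]"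
        by simp_all
      have "pcompose ([:-1, 1:] ^ p * [:1, 1:] ^ q) [:0, \<theta>:] = [:-1, -1:] ^ p * [:1, -1 :: real:] ^ q"
        by (rule poly_eq_poly_eq_iff[THEN iffD1], rule ext)
          (simp add: \<theta> poly_pcompose poly_power)
      also have "\<dots> = smult ((-1) ^ k) ([:-1, 1:] ^ q * [:1, 1:] ^ p)"
        unfolding 1 2 smult_power
        by (simp only: mult_smult_left mult_smult_right smult_smult mult_ac that[symmetric] power_add)
      finally have eq: "pcompose ([:-1, 1:] ^ p * [:1, 1:] ^ q) [:0, \<theta>:] =
          smult ((-1) ^ k) ([:-1, 1:] ^ q * [:1, 1:] ^ p)" .
      define U where "U = umbral \<delta> ([:-1, 1:] ^ q * [:1, 1:] ^ p)"
      have "c * (-1) ^ k * umbral \<gamma> ([:-1, 1:] ^ p * [:1, 1:] ^ q) = (c * c) * ((-1) ^ k * (-1) ^ k) * U"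
        unfolding signed eq umbral_smult U_def[symmetric] by (simp only: mult_ac)
      also have "\<dots> = U" using c by (simp flip: power_mult_distrib)
      finally show ?thesis using pos[of q p] by (simp only: U_def)
    qed
    then show thesis using that[of "c * (-1) ^ k"] \<open>c \<noteq> 0\<close> by simp
  qed
qed

end

section \<open>Zeros of Hermite polynomials\<close>

lemma coeff_hermite:
  "coeff (hermite (k + 2 * j)) k = (-1) ^ j * fact (k + 2 * j) * 2 ^ k / (fact j * fact k)"
proof -
  have "coeff (hermite (k + 2 * j)) k = (\<Sum>i\<le>(k + 2 * j) div 2. if i = j then
      (-1) ^ j * fact (k + 2 * j) * 2 ^ k / (fact j * fact k) else 0)"
    unfolding hermite_def coeff_sum coeff_monom by (intro sum.cong refl) auto
  also have "\<dots> = (-1) ^ j * fact (k + 2 * j) * 2 ^ k / (fact j * fact k)" by simp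
  finally show ?thesis .
qed

lemma coeff_hermite_eq_0: "n < k \<or> odd (n + k) \<Longrightarrow> coeff (hermite n) k = 0"
  unfolding hermite_def coeff_sum coeff_monom by (intro sum.neutral) auto

lemma hermite_nonzero: "hermite n \<noteq> 0"
proof
  assume "hermite n = 0"
  then show False using coeff_hermite[of n 0] by simp
qed

lemma hermite_Suc: "hermite (Suc n) = [:0, 2:] * hermite n - pderiv (hermite n)"
proof (rule poly_eqI)
  fix k
  have rhs: "coeff ([:0, 2:] * hermite n - pderiv (hermite n)) k =
      (case k of 0 \<Rightarrow> 0 | Suc l \<Rightarrow> 2 * coeff (hermite n) l) - of_nat (Suc k) * coeff (hermite n) (Suc k)"
    by (simp add: coeff_pderiv coeff_pCons split: nat.splits)
  show "coeff (hermite (Suc n)) k = coeff ([:0, 2:] * hermite n - pderiv (hermite n)) k"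
  proof (cases "Suc n < k \<or> odd (Suc n + k)")
    case True
    then show ?thesis unfolding rhs by (auto simp: coeff_hermite_eq_0 split: nat.splits)
  next
    case False
    then have "k \<le> Suc n" "even (Suc n - k)" by auto
    then obtain j where "Suc n - k = 2 * j" by (elim evenE)
    then have j: "Suc n = k + 2 * j" using \<open>k \<le> Suc n\<close> by linarith
    have lhs: "coeff (hermite (Suc n)) k = (-1) ^ j * fact (Suc n) * 2 ^ k / (fact j * fact k)"
      unfolding j by (rule coeff_hermite)
    define E :: real where "E = (-1) ^ j * fact n * 2 ^ k / (fact j * fact k)"
    have left: "(case k of 0 \<Rightarrow> 0 | Suc l \<Rightarrow> 2 * coeff (hermite n) l) = real k * E"
    proof (cases k)
      case (Suc l)
      then have n: "n = l + 2 * j" using j by simp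
      have "coeff (hermite n) l = (-1) ^ j * fact n * 2 ^ l / (fact j * fact l)"
        unfolding n by (rule coeff_hermite)
      then show ?thesis by (simp add: E_def Suc field_simps del: of_nat_Suc)
    qed simp
    have right: "of_nat (Suc k) * coeff (hermite n) (Suc k) = - (2 * real j * E)"
    proof (cases j)
      case 0
      then show ?thesis using j by (simp add: coeff_hermite_eq_0)
    next
      case (Suc i)
      then have n: "n = Suc k + 2 * i" using j by simp
      have "coeff (hermite n) (Suc k) = (-1) ^ i * fact n * 2 ^ Suc k / (fact i * fact (Suc k))"
        unfolding n by (rule coeff_hermite)
      then show ?thesis by (simp add: E_def Suc field_simps del: of_nat_Suc)
    qed
    have "real (Suc n) * E = real k * E + 2 * real j * E" using j by (simp add: algebra_simps flip: of_nat_Suc)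
    moreover have "coeff (hermite (Suc n)) k = real (Suc n) * E" unfolding lhs E_def by simp
    ultimately show ?thesis unfolding rhs left right by simp
  qed
qed

text \<open>In the upper half-plane \<open>2s\<close> has positive imaginary part and the logarithmic derivative of \<open>H\<^sub>n\<close> does
not, so \<open>2s H\<^sub>n - H\<^sub>n'\<close> cannot vanish at \<open>s\<close>.\<close>

lemma only_real_zeros_hermite: "only_real_zeros (hermite n)"
proof (induction n)
  case 0
  show ?case by (rule only_real_zerosI) (simp add: hermite_def monom_0)
next
  case (Suc n)
  let ?p = "complex_poly (hermite n)"
  show ?case
  proof (rule only_real_zerosI)
    fix s :: complex assume s: "Im s > 0"
    have ps: "poly ?p s \<noteq> 0" using only_real_zerosD[OF Suc hermite_nonzero] s by force
    have "Im (poly (pderiv ?p) s / poly ?p s) \<le> 0"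
    proof (cases "degree (hermite n) = 0")
      case True
      then have "pderiv ?p = 0" by (simp add: pderiv_eq_0_iff)
      then show ?thesis by simp
    next
      case False
      then have "Im (poly (pderiv ?p) s / poly ?p s) < 0"
        using only_real_zerosD[OF Suc hermite_nonzero] s by (intro Im_log_derivative_neg) auto
      then show ?thesis by simp
    qed
    moreover have "poly (complex_poly (hermite (Suc n))) s =
        poly ?p s * (2 * s - poly (pderiv ?p) s / poly ?p s)"
      using ps by (simp add: hermite_Suc field_simps)
    moreover have "2 * s \<noteq> poly (pderiv ?p) s / poly ?p s" if "Im (poly (pderiv ?p) s / poly ?p s) \<le> 0"
    proof
      assume "2 * s = poly (pderiv ?p) s / poly ?p s"
      then have "Im (2 * s) \<le> 0" using that by simp
      then show False using s by simp
    qed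
    ultimately show "poly (complex_poly (hermite (Suc n))) s \<noteq> 0" using ps by auto
  qed
qed

section \<open>Zeros of the coefficient polynomials\<close>

lemma poly_half_degree:
  "poly (complex_poly (\<Sum>j\<le>k div 2. monom (b j) (k - 2 * j))) w =
     w ^ (k mod 2) * (\<Sum>i\<le>k div 2. of_real (b (k div 2 - i)) * (w\<^sup>2) ^ i)"
proof -
  let ?m = "k div 2"
  have "poly (complex_poly (\<Sum>j\<le>?m. monom (b j) (k - 2 * j))) w = (\<Sum>j\<le>?m. of_real (b j) * w ^ (k - 2 * j))"
    by (simp add: poly_sum poly_monom)
  also have "\<dots> = (\<Sum>i\<le>?m. of_real (b (?m - i)) * w ^ (k - 2 * (?m - i)))"
    by (rule sum.reindex_bij_witness[of _ "\<lambda>i. ?m - i" "\<lambda>i. ?m - i"]) auto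
  also have "\<dots> = (\<Sum>i\<le>?m. w ^ (k mod 2) * (of_real (b (?m - i)) * (w\<^sup>2) ^ i))"
  proof (intro sum.cong refl)
    fix i assume "i \<in> {..?m}"
    then have "k - 2 * (?m - i) = k mod 2 + 2 * i" by (auto simp: minus_mult_div_eq_mod[symmetric])
    then show "of_real (b (?m - i)) * w ^ (k - 2 * (?m - i)) = w ^ (k mod 2) * (of_real (b (?m - i)) * (w\<^sup>2) ^ i)"
      by (simp add: power_add power_mult)
  qed
  finally show ?thesis by (simp add: sum_distrib_left)
qed

text \<open>The coefficient of \<open>x^(k-2j)\<close> in \<open>H\<^sub>k / (2^k k!)\<close>.\<close>

definition hermite_half_coeff :: "nat \<Rightarrow> nat \<Rightarrow> real" where
  "hermite_half_coeff k j = (-1) ^ j / (fact j * fact (k - 2 * j) * 4 ^ j)"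

text \<open>The zeros are squares of zeros of \<open>H\<^sub>k\<close>, hence nonnegative, and the constant coefficient does not vanish.\<close>

lemma hermite_half_root_positive:
  assumes root: "(\<Sum>i\<le>k div 2. of_real (hermite_half_coeff k (k div 2 - i)) * z ^ i) = (0 :: complex)"
  shows "Im z = 0" and "Re z > 0"
proof -
  define w where "w = csqrt z"
  have w: "w\<^sup>2 = z" by (simp add: w_def)
  have "hermite k = smult (fact k * 2 ^ k) (\<Sum>j\<le>k div 2. monom (hermite_half_coeff k j) (k - 2 * j))"
    unfolding hermite_def smult_sum_distrib smult_monom
  proof (intro sum.cong refl)
    fix j assume "j \<in> {..k div 2}"
    then have "(2::real) ^ k = 2 ^ (k - 2 * j) * 2 ^ (2 * j)" by (auto simp flip: power_add)
    then have "(2::real) ^ k = 2 ^ (k - 2 * j) * 4 ^ j" by (simp add: power_mult)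
    then show "monom ((-1) ^ j * fact k * 2 ^ (k - 2 * j) / (fact j * fact (k - 2 * j))) (k - 2 * j) =
        monom (fact k * 2 ^ k * hermite_half_coeff k j) (k - 2 * j)"
      by (simp add: hermite_half_coeff_def)
  qed
  then have "poly (complex_poly (hermite k)) w = 0"
    using root by (simp add: poly_half_degree w del: complex_poly_sum)
  then have "Im w = 0" using only_real_zerosD[OF only_real_zeros_hermite hermite_nonzero] by blast
  then have z: "z = of_real ((Re w)\<^sup>2)" using w by (simp add: complex_eq_iff power2_eq_square)
  have "z \<noteq> 0"
  proof
    assume "z = 0"
    then have "hermite_half_coeff k (k div 2) = 0" using root by (simp add: power_0_left sum.atMost_shift)
    then show False by (simp add: hermite_half_coeff_def)
  qed
  then show "Im z = 0" "Re z > 0" unfolding z by auto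
qed

context hermite_multiplier
begin

text \<open>With \<open>g\<close> the sequence of \<open>(k - m)\<close>-th differences, the sum in the hypothesis is the umbral functional
of \<open>g\<close> at the polynomial \<open>\<Phi>\<close> below, that is, the apolar pairing of \<open>\<Phi>\<close> with a Jensen polynomial of
\<open>g\<close>. As \<open>\<Phi>\<close> has all its zeros in the lower half-plane, the pairing vanishes only if that Jensen
polynomial is zero.\<close>

lemma half_polynomial_upper_half_plane:
  fixes k :: nat
  defines "m \<equiv> k div 2"
  defines "W \<equiv> \<lambda>i. umbral \<gamma> ([:-1, 1:] ^ (k - m + i) * [:1, 1:] ^ (m - i))"
  assumes y: "Im y > 0" and root: "(\<Sum>i\<le>m. of_real (hermite_half_coeff k (m - i) * W i) * y ^ i) = 0"
    and "i \<le> m"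
  shows "W i = 0"
proof -
  define g where "g = (forward_difference ^^ (k - m)) \<gamma>"
  define r where "r i = hermite_half_coeff k (m - i)" for i
  have W: "W i = umbral g ([:-1, 1:] ^ i * [:1, 1:] ^ (m - i))" for i
    by (simp only: W_def g_def umbral_forward_difference[symmetric] power_add mult.assoc)
  define B :: "nat \<Rightarrow> complex poly" where "B i = [:-1, 1:] ^ i * [:1, 1:] ^ (m - i)" for i
  define \<Phi> where "\<Phi> = (\<Sum>i\<le>m. smult (of_real (r i) * y ^ i) (B i))"
  have r_root: "Im z = 0 \<and> Re z > 0" if "(\<Sum>i\<le>m. of_real (r i) * z ^ i) = 0" for z :: complex
    using hermite_half_root_positive[of k z] that unfolding r_def m_def by blast
  have degB: "degree (B i) = m" if "i \<le> m" for i
    using that by (simp add: B_def degree_mult_eq degree_linear_power)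
  have leadB: "coeff (B i) m = 1" if "i \<le> m" for i
  proof -
    have "lead_coeff (B i) = 1"
      unfolding B_def lead_coeff_mult lead_coeff_power by simp
    then show ?thesis using degB[OF that] by simp
  qed
  have "coeff \<Phi> m = (\<Sum>i\<le>m. of_real (r i) * y ^ i)"
    unfolding \<Phi>_def coeff_sum coeff_smult by (intro sum.cong) (auto simp: leadB)
  also have "\<dots> \<noteq> 0" using r_root[of y] y by auto
  finally have lead: "coeff \<Phi> m \<noteq> 0" .
  have "degree \<Phi> \<le> m"
    unfolding \<Phi>_def by (intro degree_sum_le) (auto intro: order_trans[OF degree_smult_le] simp: degB)
  then have deg: "degree \<Phi> = m" using lead by (simp add: le_antisym le_degree)
  have lower: "Im s < 0" if s: "poly \<Phi> s = 0" for s
  proof -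
    have eval: "poly \<Phi> s = (\<Sum>i\<le>m. of_real (r i) * (y * (s - 1)) ^ i * (s + 1) ^ (m - i))"
      by (simp add: \<Phi>_def B_def poly_sum poly_power power_mult_distrib mult_ac add.commute)
    have "s \<noteq> -1"
    proof
      assume "s = -1"
      then have "poly \<Phi> s = (\<Sum>i\<le>m. if i = m then of_real (r m) * (y * (-2)) ^ m else 0)"
        unfolding eval by (intro sum.cong) (auto simp: power_0_left)
      then have "of_real (r m) * (y * (-2)) ^ m = 0" using s by simp
      moreover have "r m \<noteq> 0" by (simp add: r_def hermite_half_coeff_def)
      ultimately show False using y by auto
    qed
    then have s1: "s + 1 \<noteq> 0" by (simp add: add_eq_0_iff2)
    \<comment> \<open>In terms of \<open>z\<close>, up to a power of \<open>s + 1\<close>, the polynomial \<open>\<Phi>\<close> is the one obtained from \<open>H\<^sub>k\<close>.\<close>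
    define z where "z = y * (s - 1) / (s + 1)"
    have "poly \<Phi> s = (s + 1) ^ m * (\<Sum>i\<le>m. of_real (r i) * z ^ i)"
      unfolding eval sum_distrib_left
    proof (intro sum.cong refl)
      fix i assume "i \<in> {..m}"
      then have "(s + 1) ^ m = (s + 1) ^ i * (s + 1) ^ (m - i)" by (simp flip: power_add)
      then show "of_real (r i) * (y * (s - 1)) ^ i * (s + 1) ^ (m - i) = (s + 1) ^ m * (of_real (r i) * z ^ i)"
        using s1 by (simp add: z_def power_divide field_simps)
    qed
    then have z: "Im z = 0" "Re z > 0" using r_root s s1 by auto
    have "y - z \<noteq> 0" using y z by auto
    have "z * (s + 1) = y * (s - 1)" using s1 by (simp add: z_def)
    then have "s = (y + z) / (y - z)" using \<open>y - z \<noteq> 0\<close> by (simp add: field_simps)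
    moreover have "Im ((y + z) / (y - z)) = - 2 * Re z * Im y / (cmod (y - z))\<^sup>2"
      unfolding Im_divide cmod_power2 using z by (simp add: algebra_simps)
    ultimately show "Im s < 0" using y z \<open>y - z \<noteq> 0\<close> by (simp add: divide_less_0_iff)
  qed
  have B: "B i = complex_poly ([:-1, 1:] ^ i * [:1, 1:] ^ (m - i))" for i
    by (simp add: B_def)
  have "umbral (\<lambda>n. of_real (g n)) \<Phi> = (\<Sum>i\<le>m. of_real (r i * W i) * y ^ i)"
    unfolding \<Phi>_def umbral_sum umbral_smult B umbral_of_real W by (intro sum.cong refl) simp
  also have "\<dots> = 0" using root by (simp add: r_def)
  finally have "(\<Sum>n\<le>m. of_real (coeff (jensen_poly g m) n) * coeff \<Phi> n / of_nat (m choose n)) = 0"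
    by (simp add: umbral_def deg coeff_jensen_poly mult_ac)
  moreover have "only_real_zeros (jensen_poly g m)"
    using jensen_real_rooted_difference[OF jensen_real, of "k - m"]
    unfolding g_def jensen_real_rooted_def by blast
  moreover have "\<Phi> \<noteq> 0" using lead by auto
  ultimately have "jensen_poly g m = 0"
    using grace_nonvanishing[of "jensen_poly g m" m \<Phi>] degree_jensen_poly deg lower by blast
  then have "g n = 0" if "n \<le> m" for n
    using coeff_jensen_poly[of g m n] that by simp
  moreover have "degree ([:-1, 1 :: real:] ^ i * [:1, 1:] ^ (m - i)) = m"
    using \<open>i \<le> m\<close> by (simp add: degree_mult_eq degree_linear_power)
  ultimately show "W i = 0" unfolding W by (simp add: umbral_def)
qed

text \<open>The polynomial is \<open>w^e R(w^2)\<close> with \<open>e \<le> 1\<close>, so it has only real zeros once all zeros of \<open>R\<close> are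
real and nonnegative.\<close>

theorem diff_coeff_only_real_zeros:
  assumes nontrivial: "\<not> trivial_sequence \<gamma>"
  shows "only_real_zeros (hermite_diff_coeff \<gamma> k)"
proof -
  define m where "m = k div 2"
  define W where "W i = umbral \<gamma> ([:-1, 1:] ^ (k - m + i) * [:1, 1:] ^ (m - i))" for i
  define r where "r i = hermite_half_coeff k (m - i)" for i
  define R where "R y = (\<Sum>i\<le>m. of_real (r i * W i) * y ^ i)" for y :: complex
  have Q: "poly (complex_poly (hermite_diff_coeff \<gamma> k)) w = w ^ (k mod 2) * R (w\<^sup>2)" for w
  proof -
    have "poly (complex_poly (hermite_diff_coeff \<gamma> k)) w = w ^ (k mod 2) *
      (\<Sum>i\<le>m. of_real (hermite_half_coeff k (m - i) * umbral \<gamma> ([:-1, 1:] ^ (k - (m - i)) * [:1, 1:] ^ (m - i))) * (w\<^sup>2) ^ i)"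
      unfolding hermite_diff_coeff_def hermite_half_coeff_def[symmetric] poly_half_degree m_def ..
    also have "(\<Sum>i\<le>m. of_real (hermite_half_coeff k (m - i) * umbral \<gamma> ([:-1, 1:] ^ (k - (m - i)) * [:1, 1:] ^ (m - i))) * (w\<^sup>2) ^ i) = R (w\<^sup>2)"
      unfolding R_def r_def W_def
    proof (intro sum.cong refl)
      fix i assume "i \<in> {..m}"
      then have "k - (m - i) = k - m + i" by (auto simp: m_def)
      then show "of_real (hermite_half_coeff k (m - i) * umbral \<gamma> ([:-1, 1:] ^ (k - (m - i)) * [:1, 1:] ^ (m - i))) * (w\<^sup>2) ^ i =
        of_real (hermite_half_coeff k (m - i) * umbral \<gamma> ([:-1, 1:] ^ (k - m + i) * [:1, 1:] ^ (m - i))) * (w\<^sup>2) ^ i"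
        by (simp only:)
    qed
    finally show ?thesis .
  qed
  show ?thesis
  proof (cases "\<forall>i\<le>m. W i = 0")
    case True
    then have "R y = 0" for y by (simp add: R_def)
    then have "poly (complex_poly (hermite_diff_coeff \<gamma> k)) w = 0" for w by (simp add: Q)
    then have "complex_poly (hermite_diff_coeff \<gamma> k) = 0" using poly_all_0_iff_0 by blast
    then show ?thesis by simp
  next
    case False
    have upper: "R y \<noteq> 0" if "Im y > 0" for y
      using half_polynomial_upper_half_plane[of y k] that False
      unfolding R_def r_def W_def m_def by blast
    have cnj: "R (cnj y) = cnj (R y)" for y by (simp add: R_def)
    have real: "Im y = 0" if "R y = 0" for y
    proof (rule ccontr)
      assume "Im y \<noteq> 0"
      then consider "Im y > 0" | "Im (cnj y) > 0" by fastforce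
      then show False using upper[of y] upper[of "cnj y"] that cnj[of y] by cases auto
    qed
    have nonneg: "v \<le> 0" if "R (of_real (- v)) = 0" for v :: real
    proof (rule ccontr)
      assume "\<not> v \<le> 0"
      then have v: "v > 0" by simp
      obtain \<tau> :: real where \<tau>: "\<tau> \<noteq> 0"
        "\<And>p q. p + q = k \<Longrightarrow> \<tau> * umbral \<gamma> ([:-1, 1:] ^ p * [:1, 1:] ^ q) \<ge> 0"
        by (rule differences_sign[OF nontrivial, of k], rule that)
      define a where "a i = 1 / (fact (m - i) * fact (k - 2 * (m - i)) * 4 ^ (m - i)) * v ^ i" for i
      have a: "a i > 0" for i using v by (simp add: a_def)
      \<comment> \<open>At a negative point all terms of \<open>R\<close> have the same sign, so a zero forces each of them to vanish.\<close>
      have "(-1) ^ m * \<tau> * (\<Sum>i\<le>m. r i * W i * (- v) ^ i) = (\<Sum>i\<le>m. a i * (\<tau> * W i))"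
        unfolding sum_distrib_left
      proof (intro sum.cong refl)
        fix i assume "i \<in> {..m}"
        then have "(-1 :: real) ^ m = (-1) ^ (m - i) * (-1) ^ i" by (simp flip: power_add)
        moreover have "((-1 :: real) ^ i * (-1) ^ i) = 1" "((-1 :: real) ^ (m - i) * (-1) ^ (m - i)) = 1"
          by (simp_all flip: power_mult_distrib)
        moreover have "(- v) ^ i = (-1) ^ i * v ^ i" by (rule power_minus)
        ultimately have "(-1) ^ m * ((-1) ^ (m - i) * (- v) ^ i) = v ^ i"
          by (simp add: algebra_simps)
        moreover have "r i = (-1) ^ (m - i) * (1 / (fact (m - i) * fact (k - 2 * (m - i)) * 4 ^ (m - i)))"
          by (simp add: r_def hermite_half_coeff_def)
        then have "(-1) ^ m * \<tau> * (r i * W i * (- v) ^ i) =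
           ((-1) ^ m * ((-1) ^ (m - i) * (- v) ^ i)) *
           (1 / (fact (m - i) * fact (k - 2 * (m - i)) * 4 ^ (m - i)) * (\<tau> * W i))"
          by (simp only: mult_ac)
        ultimately show "(-1) ^ m * \<tau> * (r i * W i * (- v) ^ i) = a i * (\<tau> * W i)"
          by (simp only: a_def mult_ac)
      qed
      also have "(\<Sum>i\<le>m. r i * W i * (- v) ^ i) = 0"
      proof -
        have "R (of_real (- v)) = of_real (\<Sum>i\<le>m. r i * W i * (- v) ^ i)" by (simp add: R_def)
        then show ?thesis using that by (metis of_real_eq_0_iff)
      qed
      finally have sum0: "(\<Sum>i\<le>m. a i * (\<tau> * W i)) = 0" by simp
      have "a i * (\<tau> * W i) \<ge> 0" if "i \<in> {..m}" for i
      proof -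
        have "k - m + i + (m - i) = k" using that by (auto simp: m_def)
        then have "\<tau> * W i \<ge> 0" unfolding W_def by (rule \<tau>(2))
        then show ?thesis using a[of i] by simp
      qed
      then have "\<forall>i\<in>{..m}. a i * (\<tau> * W i) = 0" using sum0 by (subst (asm) sum_nonneg_eq_0_iff) auto
      then have "\<forall>i\<le>m. W i = 0" using a \<tau>(1) by (metis atMost_iff less_irrefl mult_eq_0_iff)
      then show False using False by simp
    qed
    show ?thesis
      unfolding only_real_zeros_def
    proof (intro disjI2 allI impI)
      fix w assume "poly (complex_poly (hermite_diff_coeff \<gamma> k)) w = 0"
      then consider "w = 0" | "R (w\<^sup>2) = 0" by (auto simp: Q)
      then show "w \<in> \<real>"
      proof cases
        case 2
        then have im: "Im (w\<^sup>2) = 0" by (rule real)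
        then have "w\<^sup>2 = of_real (- (- Re (w\<^sup>2)))" by (simp add: complex_eq_iff)
        then have "- Re (w\<^sup>2) \<le> 0" using nonneg 2 by metis
        moreover have "Re w = 0 \<or> Im w = 0" using im by (simp add: Im_power2)
        ultimately have "Im w = 0" by (auto simp: Re_power2)
        then show ?thesis by (simp add: complex_is_Real_iff)
      qed simp
    qed
  qed
qed

end

theorem theorem40:
  fixes \<gamma> :: "nat \<Rightarrow> real" and Q :: "nat \<Rightarrow> real poly"
  assumes "hermite_multiplier_sequence \<gamma>"
    and "\<not> trivial_sequence \<gamma>"
    and "\<forall>n. diff_operator Q (hermite n) = smult (\<gamma> n) (hermite n)"
  shows "\<forall>k. only_real_zeros (Q k)"
proof
  fix k
  obtain T where T: "Vector_Spaces.linear smult smult T"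
    "\<And>n. T (hermite n) = smult (\<gamma> n) (hermite n)" "hyperbolicity_preserving T"
    using assms(1) unfolding hermite_multiplier_sequence_def by blast
  interpret hermite_multiplier T \<gamma>
    by (rule hermite_multiplier.intro) (use T in \<open>auto simp: hyperbolicity_preserving_def\<close>)
  have "Q k = hermite_diff_coeff \<gamma> k" using assms(3) by (intro diff_operator_coeffs) blast
  then show "only_real_zeros (Q k)" using diff_coeff_only_real_zeros[OF assms(2)] by simp
qed

end
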